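(* Let $G$ be a compact metric tree. If there is an eigenfunction of the Laplacian (the Schrödinger operator with $q=0$) corresponding to $\lambda_2(G,0)$ which vanishes identically on an edge, then, for any $M>0$, the potential $q=0$ does not minimize $\Gamma[q]$ in $C_{G,M}$.
   Context: A compact metric graph consists of finitely many edges, each identified with a compact interval $[0,|e|]$, $|e|>0$, whose endpoints are partitioned into finitely many classes (vertices) and glued accordingly; it is always assumed connected. A tree is a connected metric graph without cycles; a leaf is a vertex of degree one, and the boundary of a tree is the set of its leaves. For a real potential $q$ on $G$, $H u=-u''+qu$ is the self-adjoint Schrödinger operator on $L^2(G)$ with standard (Kirchhoff) vertex conditions: continuity at each vertex and, at each vertex, the sum of the normal derivatives along all incident edges equals $0$. Its eigenvalues counted with multiplicity are $\lambda_1(G,q)<\lambda_2(G,q)\le\dots$, and $\Gamma[q]=\lambda_2(G,q)-\lambda_1(G,q)$. For a tree $G$ and $M>0$, $C_{G,M}$ is the set of functions $q:G\to\mathbb{R}$ with $0\le q(x)\le M$ for all $x\in G$ such that $q$ is convex on every path in $G$ from one boundary vertex (leaf) to another, each path being regarded as an interval. *)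

theory Defs
  imports "HOL-Analysis.Analysis" "HOL-Library.Function_Algebras"
begin

section \<open>Compact metric graphs\<close>

text \<open>
  An edge \<open>e\<close> is the interval from \<open>0\<close> to \<open>len G e\<close>; its endpoint \<open>0\<close> is labelled \<open>(e, False)\<close>
  and its endpoint \<open>len G e\<close> is labelled \<open>(e, True)\<close>. The map \<open>vert G\<close> encodes the partition of
  the endpoints into vertices: two endpoints are glued iff they have the same image.
  Loops and parallel edges are allowed.
\<close>

record ('e, 'v) metric_graph =
  edges :: "'e set"
  len :: "'e \<Rightarrow> real"
  vert :: "'e \<times> bool \<Rightarrow> 'v"

definition ends :: "('e, 'v) metric_graph \<Rightarrow> ('e \<times> bool) set" where
  "ends G = edges G \<times> UNIV"

definition vertices :: "('e, 'v) metric_graph \<Rightarrow> 'v set" where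
  "vertices G = vert G ` ends G"

definition degree :: "('e, 'v) metric_graph \<Rightarrow> 'v \<Rightarrow> nat" where
  "degree G v = card {d \<in> ends G. vert G d = v}"

definition leaf :: "('e, 'v) metric_graph \<Rightarrow> 'v \<Rightarrow> bool" where
  "leaf G v \<longleftrightarrow> v \<in> vertices G \<and> degree G v = 1"

text \<open>
  A pair \<open>(e, b)\<close> also serves as a directed edge: the edge \<open>e\<close> traversed starting from its endpoint
  \<open>(e, b)\<close> and finishing at its other endpoint \<open>(e, \<not> b)\<close>.
\<close>

definition dhead :: "('e, 'v) metric_graph \<Rightarrow> 'e \<times> bool \<Rightarrow> 'v" where
  "dhead G d = vert G (fst d, \<not> snd d)"

fun walk :: "('e, 'v) metric_graph \<Rightarrow> 'v \<Rightarrow> ('e \<times> bool) list \<Rightarrow> 'v \<Rightarrow> bool" where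
  "walk G v [] w \<longleftrightarrow> v \<in> vertices G \<and> v = w"
| "walk G v (d # ds) w \<longleftrightarrow> d \<in> ends G \<and> vert G d = v \<and> walk G (dhead G d) ds w"

definition graph_path :: "('e, 'v) metric_graph \<Rightarrow> 'v \<Rightarrow> ('e \<times> bool) list \<Rightarrow> 'v \<Rightarrow> bool" where
  "graph_path G v ds w \<longleftrightarrow> walk G v ds w \<and> distinct (v # map (dhead G) ds)"

text \<open>Distinctness of the edges rules out walking back and forth along one edge.\<close>

definition graph_cycle :: "('e, 'v) metric_graph \<Rightarrow> ('e \<times> bool) list \<Rightarrow> bool" where
  "graph_cycle G ds \<longleftrightarrow> ds \<noteq> [] \<and> (\<exists>v. walk G v ds v)
     \<and> distinct (map fst ds) \<and> distinct (map (dhead G) ds)"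

definition compact_metric_graph :: "('e, 'v) metric_graph \<Rightarrow> bool" where
  "compact_metric_graph G \<longleftrightarrow> finite (edges G) \<and> (\<forall>e\<in>edges G. 0 < len G e)
     \<and> (\<forall>v\<in>vertices G. \<forall>w\<in>vertices G. \<exists>ds. walk G v ds w)"

definition metric_tree :: "('e, 'v) metric_graph \<Rightarrow> bool" where
  "metric_tree G \<longleftrightarrow> compact_metric_graph G \<and> (\<nexists>ds. graph_cycle G ds)"


section \<open>Functions on a metric graph\<close>

text \<open>
  A function on \<open>G\<close> is a family \<open>f\<close> of functions on the edges, \<open>f e x\<close> being relevant only for
  \<open>e \<in> edges G\<close> and \<open>x \<in> {0..len G e}\<close>, whose values at glued endpoints agree. If each \<open>f e\<close> is
  continuous, this agreement is continuity at the vertices.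
\<close>

definition end_coord :: "('e, 'v) metric_graph \<Rightarrow> 'e \<times> bool \<Rightarrow> real" where
  "end_coord G d = (if snd d then len G (fst d) else 0)"

definition well_defined_on :: "('e, 'v) metric_graph \<Rightarrow> ('e \<Rightarrow> real \<Rightarrow> real) \<Rightarrow> bool" where
  "well_defined_on G f \<longleftrightarrow> (\<forall>d\<in>ends G. \<forall>d'\<in>ends G. vert G d = vert G d' \<longrightarrow>
     f (fst d) (end_coord G d) = f (fst d') (end_coord G d'))"

definition path_length :: "('e, 'v) metric_graph \<Rightarrow> ('e \<times> bool) list \<Rightarrow> real" where
  "path_length G ds = (\<Sum>d\<leftarrow>ds. len G (fst d))"

text \<open>
  The restriction of \<open>f\<close> to the path \<open>ds\<close>, as a function of the arc length
  \<open>t \<in> {0..path_length G ds}\<close>. At the vertices between consecutive edges either edge gives the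
  same value whenever \<open>f\<close> is well defined on \<open>G\<close>.
\<close>

fun along :: "('e, 'v) metric_graph \<Rightarrow> ('e \<Rightarrow> real \<Rightarrow> real) \<Rightarrow> ('e \<times> bool) list \<Rightarrow> real \<Rightarrow> real" where
  "along G f [] t = 0"
| "along G f (d # ds) t =
     (if t \<le> len G (fst d)
      then f (fst d) (if snd d then len G (fst d) - t else t)
      else along G f ds (t - len G (fst d)))"

definition convex_potentials :: "('e, 'v) metric_graph \<Rightarrow> real \<Rightarrow> ('e \<Rightarrow> real \<Rightarrow> real) set" where
  "convex_potentials G M = {q. well_defined_on G q
     \<and> (\<forall>e\<in>edges G. \<forall>x\<in>{0..len G e}. 0 \<le> q e x \<and> q e x \<le> M)
     \<and> (\<forall>v ds w. leaf G v \<and> leaf G w \<and> v \<noteq> w \<and> graph_path G v ds w \<longrightarrow>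
          convex_on {0..path_length G ds} (along G q ds))}"

text \<open>The zero potential is admissible, so failing to minimise is not due to inadmissibility.\<close>

lemma along_zero [simp]: "along G (\<lambda>_ _. 0) ds t = 0"
  by (induction ds arbitrary: t) auto

lemma zero_in_convex_potentials: "M > 0 \<Longrightarrow> (\<lambda>_ _. 0) \<in> convex_potentials G M"
  by (auto simp: convex_potentials_def well_defined_on_def convex_on_def)


section \<open>Schroedinger operators and their eigenvalues\<close>

text \<open>
  \<open>f\<close> belongs to the Sobolev space \<open>H\<^sup>2(0,l)\<close>, with first and second derivatives \<open>f'\<close> and \<open>f''\<close>:
  \<open>f\<close> is continuously differentiable and \<open>f'\<close> is the indefinite integral of the
  square-integrable function \<open>f''\<close>.
\<close>

definition H2_on :: "real \<Rightarrow> (real \<Rightarrow> real) \<Rightarrow> (real \<Rightarrow> real) \<Rightarrow> (real \<Rightarrow> real) \<Rightarrow> bool" where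
  "H2_on l f f' f'' \<longleftrightarrow>
     (\<forall>x\<in>{0..l}. (f has_real_derivative f' x) (at x within {0..l}))
     \<and> (\<forall>x\<in>{0..l}. (f'' has_integral (f' x - f' 0)) {0..x})
     \<and> f'' \<in> borel_measurable (lebesgue_on {0..l})
     \<and> integrable (lebesgue_on {0..l}) (\<lambda>x. (f'' x)\<^sup>2)"

text \<open>The derivative at the endpoint \<open>d\<close>, directed into the edge.\<close>

definition normal_deriv :: "('e, 'v) metric_graph \<Rightarrow> ('e \<Rightarrow> real \<Rightarrow> real) \<Rightarrow> 'e \<times> bool \<Rightarrow> real" where
  "normal_deriv G u' d = (if snd d then - u' (fst d) (end_coord G d) else u' (fst d) (end_coord G d))"

definition kirchhoff :: "('e, 'v) metric_graph \<Rightarrow> ('e \<Rightarrow> real \<Rightarrow> real) \<Rightarrow> bool" where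
  "kirchhoff G u' \<longleftrightarrow>
     (\<forall>v\<in>vertices G. (\<Sum>d | d \<in> ends G \<and> vert G d = v. normal_deriv G u' d) = 0)"

text \<open>
  \<open>schroedinger G q u w\<close>: the function \<open>u\<close> is in the domain of \<open>H\<close> and \<open>H u = - u'' + q u = w\<close> in
  \<open>L\<^sup>2(G)\<close>. The domain is the one for bounded measurable potentials \<open>q\<close>.
\<close>

definition schroedinger ::
    "('e, 'v) metric_graph \<Rightarrow> ('e \<Rightarrow> real \<Rightarrow> real) \<Rightarrow> ('e \<Rightarrow> real \<Rightarrow> real) \<Rightarrow> ('e \<Rightarrow> real \<Rightarrow> real) \<Rightarrow> bool" where
  "schroedinger G q u w \<longleftrightarrow> well_defined_on G u \<and>
     (\<exists>u' u''. (\<forall>e\<in>edges G. H2_on (len G e) (u e) (u' e) (u'' e)) \<and> kirchhoff G u' \<and>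
        (\<forall>e\<in>edges G. AE x in lebesgue_on {0..len G e}. - u'' e x + q e x * u e x = w e x))"

text \<open>
  The elements of an eigenspace are normalised to be zero outside the graph, so that they are equal
  iff they are equal as functions on \<open>G\<close>.
\<close>

definition eigenspace ::
    "('e, 'v) metric_graph \<Rightarrow> ('e \<Rightarrow> real \<Rightarrow> real) \<Rightarrow> real \<Rightarrow> ('e \<Rightarrow> real \<Rightarrow> real) set" where
  "eigenspace G q \<mu> = {u. schroedinger G q u (\<lambda>e x. \<mu> * u e x)
     \<and> (\<forall>e x. \<not> (e \<in> edges G \<and> x \<in> {0..len G e}) \<longrightarrow> u e x = 0)}"

definition eigenfunction ::
    "('e, 'v) metric_graph \<Rightarrow> ('e \<Rightarrow> real \<Rightarrow> real) \<Rightarrow> real \<Rightarrow> ('e \<Rightarrow> real \<Rightarrow> real) \<Rightarrow> bool" where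
  "eigenfunction G q \<mu> u \<longleftrightarrow> u \<in> eigenspace G q \<mu> \<and> u \<noteq> (\<lambda>_ _. 0)"

definition fun_scale :: "real \<Rightarrow> ('e \<Rightarrow> real \<Rightarrow> real) \<Rightarrow> 'e \<Rightarrow> real \<Rightarrow> real" where
  "fun_scale c u = (\<lambda>e x. c * u e x)"

global_interpretation funs: vector_space fun_scale
  defines funs_dim = funs.dim
  by unfold_locales (auto simp: fun_scale_def fun_eq_iff algebra_simps)

text \<open>The multiplicity of \<open>\<mu>\<close> as an eigenvalue; it is \<open>0\<close> if \<open>\<mu>\<close> is not an eigenvalue.\<close>

definition multiplicity_eig :: "('e, 'v) metric_graph \<Rightarrow> ('e \<Rightarrow> real \<Rightarrow> real) \<Rightarrow> real \<Rightarrow> nat" where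
  "multiplicity_eig G q \<mu> = funs_dim (eigenspace G q \<mu>)"

text \<open>
  \<open>eigenvalue G q k\<close> is the \<open>k\<close>-th eigenvalue (\<open>k \<ge> 1\<close>) in nondecreasing order, counted with
  multiplicity, i.e. the least \<open>x\<close> such that at least \<open>k\<close> eigenvalues, counted with multiplicity,
  lie in \<open>{..x}\<close>. The finite set \<open>F\<close> avoids the convention that sums over infinite sets are zero.
\<close>

definition eigenvalue :: "('e, 'v) metric_graph \<Rightarrow> ('e \<Rightarrow> real \<Rightarrow> real) \<Rightarrow> nat \<Rightarrow> real" where
  "eigenvalue G q k = Inf {x. \<exists>F. finite F \<and> F \<subseteq> {..x} \<and> k \<le> (\<Sum>\<mu>\<in>F. multiplicity_eig G q \<mu>)}"

definition spectral_gap :: "('e, 'v) metric_graph \<Rightarrow> ('e \<Rightarrow> real \<Rightarrow> real) \<Rightarrow> real" where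
  "spectral_gap G q = eigenvalue G q 2 - eigenvalue G q 1"

end

theory Submission
  imports Defs
begin

text \<open>
  Let \<open>\<nu> = \<lambda>\<^sub>2(G, 0)\<close>. For \<open>q = 0\<close> the constants are eigenfunctions for \<open>\<lambda>\<^sub>1 = 0\<close>, so the gap is \<open>\<nu>\<close>. The idea is
  to place a small potential where an eigenfunction for \<open>\<nu>\<close> vanishes. This eigenfunction does not
  notice the potential, so \<open>\<nu>\<close> remains an eigenvalue, but the lowest eigenvalue is pushed above \<open>0\<close>
  and the gap shrinks.

  To have convexity along all paths, the potential is put on a leaf edge, where it grows from \<open>0\<close>
  towards the leaf. Let \<open>u\<close> vanish on the edge \<open>e\<close>. The tree falls apart at \<open>e\<close>, and \<open>u\<close> is nonzero on one of
  the two sides; setting it to \<open>0\<close> on the other side, which contains a leaf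
  (\<open>tree_order_cut\<close>), gives another eigenfunction (\<open>cut_eigenfunction\<close>).

  It remains to control the bottom of the spectrum of the perturbed operator. Instead of fixing a potential and looking for its lowest eigenvalue, one prescribes
  a small \<open>\<mu> > 0\<close> and constructs a potential on the leaf edge together with a positive
  eigenfunction for \<open>\<mu>\<close> (\<open>positive_solution\<close>). Off the leaf edge the eigenfunction is made of sines and
  cosines, found by peeling off the tree down to the leaf edge; there only the logarithmic
  derivative at the inner endpoint is prescribed, and one writes down a suitable positive function
  and reads off its potential (\<open>leaf_edge_solution\<close>). It is convex because \<open>\<mu>\<close> is small.

  By Picone's identity a positive eigenfunction belongs to the lowest eigenvalue
  (\<open>ground_state_comparison\<close>). Hence the perturbed operator has \<open>\<lambda>\<^sub>1 = \<mu>\<close> and \<open>\<lambda>\<^sub>2 \<le> \<nu>\<close>, and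
  its gap is at most \<open>\<nu> - \<mu> < \<nu>\<close>. The same identity, with the constants as positive eigenfunction, settles the
  case \<open>q = 0\<close>, including \<open>\<nu> > 0\<close>.
\<close>

section \<open>Building a tree edge by edge\<close>

text \<open>
  A connected graph without cycles can be built by attaching one edge at a time, each new edge sharing
  exactly one vertex with what is already there. Cutting a tree at an edge and solving an equation on
  it are then inductions along such an order.
\<close>

definition endpoints :: "('e, 'v) metric_graph \<Rightarrow> 'e set \<Rightarrow> 'v set" where
  "endpoints G S = vert G ` (S \<times> UNIV)"

text \<open>
  The list is in reverse order of attachment: its last element is the root edge \<open>f\<close>, and each other
  edge is attached with its tail \<open>vert G d\<close> to an old vertex, while its head is new.
\<close>

inductive tree_order :: "('e, 'v) metric_graph \<Rightarrow> 'e \<Rightarrow> 'e list \<Rightarrow> bool" for G f where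
  root: "f \<in> edges G \<Longrightarrow> tree_order G f [f]"
| attach: "tree_order G f es \<Longrightarrow> fst d \<in> edges G \<Longrightarrow> vert G d \<in> endpoints G (set es) \<Longrightarrow>
    dhead G d \<notin> endpoints G (set es) \<Longrightarrow> tree_order G f (fst d # es)"

lemma vert_in_endpoints: "fst d \<in> S \<Longrightarrow> vert G d \<in> endpoints G S"
  by (cases d) (auto simp: endpoints_def)

lemma dhead_in_endpoints: "fst d \<in> S \<Longrightarrow> dhead G d \<in> endpoints G S"
  by (auto simp: endpoints_def dhead_def)

lemma end_cases: "fst d' = fst d \<Longrightarrow> d' = d \<or> d' = (fst d, \<not> snd d)"
  by (cases d; cases d') auto

lemma endpoints_insert: "endpoints G (insert (fst d) S) = insert (vert G d) (insert (dhead G d) (endpoints G S))"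
proof -
  have "vert G ` ({fst d} \<times> UNIV) = {vert G d, dhead G d}"
    by (cases d; cases "snd d") (auto simp: UNIV_bool dhead_def)
  moreover have "insert (fst d) S \<times> (UNIV :: bool set) = {fst d} \<times> UNIV \<union> S \<times> UNIV"
    by auto
  ultimately show ?thesis
    by (simp add: endpoints_def image_Un)
qed

lemma tree_order_edges: "tree_order G f es \<Longrightarrow> set es \<subseteq> edges G \<and> f \<in> set es \<and> distinct es"
  by (induction rule: tree_order.induct) (auto simp: dhead_in_endpoints)

lemma walk_append: "walk G a p b \<Longrightarrow> walk G b r c \<Longrightarrow> walk G a (p @ r) c"
  by (induction p arbitrary: a) auto

lemma walk_appendD: "walk G a (p @ r) c \<Longrightarrow> \<exists>b. walk G a p b \<and> walk G b r c"
proof (induction p arbitrary: a)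
  case Nil
  then show ?case by (cases r) (auto simp: vertices_def)
qed auto

lemma tree_order_paths:
  assumes "tree_order G f es" "a \<in> endpoints G (set es)" "b \<in> endpoints G (set es)"
  shows "\<exists>p. graph_path G a p b \<and> fst ` set p \<subseteq> set es"
  using assms
proof (induction arbitrary: a b rule: tree_order.induct)
  case root
  have ab: "a \<in> {vert G (f, False), vert G (f, True)}" "b \<in> {vert G (f, False), vert G (f, True)}"
    using root by (auto simp: endpoints_def UNIV_bool)
  have av: "a \<in> vertices G"
    using root ab by (auto simp: vertices_def ends_def)
  show ?case
  proof (cases "a = b")
    case True
    then show ?thesis using av by (intro exI[of _ "[]"]) (auto simp: graph_path_def)
  next
    case False
    then obtain s where s: "a = vert G (f, s)" "b = vert G (f, \<not> s)"
      using ab by auto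
    then show ?thesis using False root
      by (intro exI[of _ "[(f, s)]"])
         (auto simp: graph_path_def ends_def dhead_def vertices_def)
  qed
next
  case (attach es d)
  let ?n = "dhead G d" and ?p = "vert G d"
  let ?r = "(fst d, \<not> snd d)"
  have dG: "d \<in> ends G" "?r \<in> ends G" using attach.hyps by (cases d; auto simp: ends_def)+
  have vr: "vert G ?r = ?n" "dhead G ?r = ?p" by (auto simp: dhead_def)
  have nV: "?n \<in> vertices G" using dG vr unfolding vertices_def by (metis image_eqI)
  have mem: "a = ?n \<or> a \<in> endpoints G (set es)" "b = ?n \<or> b \<in> endpoints G (set es)"
    using attach.prems attach.hyps(3) by (auto simp: endpoints_insert)
  have hd_in: "dhead G ` set p \<subseteq> endpoints G (set es)" if "fst ` set p \<subseteq> set es" for p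
    using that by (intro image_subsetI dhead_in_endpoints) auto
  consider "a = ?n" "b = ?n" | "a = ?n" "b \<in> endpoints G (set es)"
    | "a \<in> endpoints G (set es)" "b = ?n" | "a \<in> endpoints G (set es)" "b \<in> endpoints G (set es)"
    using mem by auto
  then show ?case
  proof cases
    case 1
    then show ?thesis using nV by (intro exI[of _ "[]"]) (auto simp: graph_path_def)
  next
    case 2
    obtain p where p: "graph_path G ?p p b" "fst ` set p \<subseteq> set es"
      using attach.IH[OF attach.hyps(3) 2(2)] by auto
    have "graph_path G a (?r # p) b"
      using p dG vr 2 hd_in[OF p(2)] attach.hyps(3,4) by (auto simp: graph_path_def)
    then show ?thesis using p(2) by (intro exI[of _ "?r # p"]) auto
  next
    case 3
    obtain p where p: "graph_path G a p ?p" "fst ` set p \<subseteq> set es"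
      using attach.IH[OF 3(1) attach.hyps(3)] by auto
    have "walk G a (p @ [d]) b"
      using p(1) dG nV 3 by (intro walk_append[of G a p ?p]) (auto simp: graph_path_def)
    moreover have "distinct (a # map (dhead G) (p @ [d]))"
      using p hd_in[OF p(2)] 3 attach.hyps(4) by (auto simp: graph_path_def)
    ultimately have "graph_path G a (p @ [d]) b" by (simp add: graph_path_def)
    then show ?thesis using p(2) by (intro exI[of _ "p @ [d]"]) auto
  next
    case 4
    then show ?thesis using attach.IH[of a b] by fastforce
  qed
qed

text \<open>
  An edge occurring twice would, traversed in the same direction, repeat its head and, traversed
  in the opposite direction, return to an earlier vertex.
\<close>

lemma graph_path_distinct_edges: "graph_path G v ds w \<Longrightarrow> distinct (map fst ds)"
proof (induction ds arbitrary: v)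
  case (Cons d ds)
  have gp: "graph_path G (dhead G d) ds w" using Cons.prems by (auto simp: graph_path_def)
  have "fst d \<notin> fst ` set ds"
  proof
    assume "fst d \<in> fst ` set ds"
    then obtain d' where d': "d' \<in> set ds" "fst d' = fst d" by auto
    from end_cases[OF d'(2)] show False
    proof
      assume "d' = d"
      then show False using Cons.prems d' by (auto simp: graph_path_def)
    next
      assume "d' = (fst d, \<not> snd d)"
      then have "dhead G d' = v" using Cons.prems by (auto simp: graph_path_def dhead_def)
      then show False using Cons.prems d' by (force simp: graph_path_def)
    qed
  qed
  then show ?case using Cons.IH[OF gp] by simp
qed simp

text \<open>
  A longest order contains all edges: an edge that is missing but touches the part already built
  either has a new vertex, so that the order could be extended, or has both endpoints in that part,
  and then it closes a path of old edges to a cycle.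
\<close>

lemma tree_order_exists:
  assumes tree: "metric_tree G" and f: "f \<in> edges G"
  shows "\<exists>es. tree_order G f es \<and> set es = edges G"
proof -
  have fin: "finite (edges G)" and conn: "\<And>v w. v \<in> vertices G \<Longrightarrow> w \<in> vertices G \<Longrightarrow> \<exists>ds. walk G v ds w"
    using tree by (auto simp: metric_tree_def compact_metric_graph_def)
  have len: "length es \<le> card (edges G)" if "tree_order G f es" for es
    using tree_order_edges[OF that] fin by (metis card_mono distinct_card)
  obtain es where es: "tree_order G f es" and max: "\<And>es'. tree_order G f es' \<Longrightarrow> length es' \<le> length es"
    using ex_has_greatest_nat[of "tree_order G f" "[f]" length "Suc (card (edges G))"] len
      tree_order.root[OF f] by (auto simp: less_Suc_eq_le)
  note ese = tree_order_edges[OF es]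
  have "edges G \<subseteq> set es"
  proof (rule ccontr)
    assume "\<not> edges G \<subseteq> set es"
    then obtain h where h: "h \<in> edges G" "h \<notin> set es" by auto
    \<comment> \<open>By connectedness some missing edge touches what has been built.\<close>
    have "\<exists>d. fst d \<in> edges G \<and> fst d \<notin> set es \<and> vert G d \<in> endpoints G (set es)"
    proof (rule ccontr)
      assume no: "\<not> ?thesis"
      have stay: "walk G v ds w \<Longrightarrow> v \<in> endpoints G (set es) \<Longrightarrow> w \<in> endpoints G (set es)" for v ds w
      proof (induction ds arbitrary: v)
        case (Cons d ds)
        then have "fst d \<in> set es" using no by (auto simp: ends_def)
        then show ?case using Cons dhead_in_endpoints[of d "set es" G] by auto
      qed simp
      have "vert G (f, False) \<in> vertices G" "vert G (h, False) \<in> vertices G"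
        using f h by (auto simp: vertices_def ends_def)
      then obtain ds where "walk G (vert G (f, False)) ds (vert G (h, False))" using conn by blast
      then have "vert G (h, False) \<in> endpoints G (set es)"
        using stay vert_in_endpoints[of "(f, False)" "set es" G] ese by auto
      then show False using no h by (metis fst_conv)
    qed
    then obtain d where d: "fst d \<in> edges G" "fst d \<notin> set es" "vert G d \<in> endpoints G (set es)"
      by auto
    show False
    proof (cases "dhead G d \<in> endpoints G (set es)")
      case True
      obtain p where p: "graph_path G (dhead G d) p (vert G d)" "fst ` set p \<subseteq> set es"
        using tree_order_paths[OF es True d(3)] by auto
      have "d \<in> ends G" using d by (cases d) (auto simp: ends_def)
      then have "graph_cycle G (d # p)"
        using p d graph_path_distinct_edges[OF p(1)]
        by (auto simp: graph_cycle_def graph_path_def)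
      then show False using tree by (auto simp: metric_tree_def)
    next
      case False
      then show False using max[OF tree_order.attach[OF es d(1,3)]] by simp
    qed
  qed
  then show ?thesis using es ese by blast
qed

text \<open>
  Cutting the tree at \<open>e\<close> leaves two components; \<open>Y\<close> is the vertex set of the one that does
  not contain \<open>f\<close>. It contains a leaf, the head of \<open>d\<close>: the vertex that came last in \<open>Y\<close> is
  touched by no later edge. The induction keeps \<open>Y\<close> and this leaf up to date while edges are
  attached.
\<close>

lemma tree_order_cut:
  assumes "tree_order G f es" "e \<in> set es" "e \<noteq> f"
  shows "\<exists>Y d. vert G (f, False) \<notin> Y \<and> vert G (f, True) \<notin> Y
     \<and> (\<forall>h\<in>set es. h \<noteq> e \<longrightarrow> (vert G (h, False) \<in> Y \<longleftrightarrow> vert G (h, True) \<in> Y))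
     \<and> fst d \<in> set es \<and> dhead G d \<in> Y
     \<and> (\<forall>d'. fst d' \<in> set es \<longrightarrow> vert G d' = dhead G d \<longrightarrow> d' = (fst d, \<not> snd d))"
  using assms
proof (induction rule: tree_order.induct)
  case root
  then show ?case by auto
next
  case (attach es d)
  let ?r = "(fst d, \<not> snd d)"
  have fes: "f \<in> set es" using tree_order_edges[OF attach.hyps(1)] by simp
  have vn: "vert G d \<noteq> dhead G d" using attach.hyps(3,4) by auto
  have vends: "{vert G (fst d, False), vert G (fst d, True)} = {vert G d, dhead G d}"
    by (cases d; cases "snd d") (auto simp: dhead_def)
  have old: "vert G (h, b) \<noteq> dhead G d" if "h \<in> set es" for h b
    using attach.hyps(4) vert_in_endpoints[of "(h, b)" "set es" G] that by auto
  have uniq: "d' = ?r" if "fst d' \<in> set (fst d # es)" "vert G d' = dhead G d" for d'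
    using that vn old[of "fst d'" "snd d'"] end_cases[of d' d] by auto
  show ?case
  proof (cases "e = fst d")
    case True
    have "\<forall>h\<in>set (fst d # es). h \<noteq> e \<longrightarrow> (vert G (h, False) \<in> {dhead G d} \<longleftrightarrow> vert G (h, True) \<in> {dhead G d})"
      using True old by auto
    then show ?thesis using uniq old[OF fes]
      by (intro exI[of _ "{dhead G d}"] exI[of _ d]) auto
  next
    case False
    then have "e \<in> set es" using attach.prems by auto
    then obtain Y d1 where Y: "vert G (f, False) \<notin> Y" "vert G (f, True) \<notin> Y"
        "\<forall>h\<in>set es. h \<noteq> e \<longrightarrow> (vert G (h, False) \<in> Y \<longleftrightarrow> vert G (h, True) \<in> Y)"
        "fst d1 \<in> set es" "dhead G d1 \<in> Y"
        "\<forall>d'. fst d' \<in> set es \<longrightarrow> vert G d' = dhead G d1 \<longrightarrow> d' = (fst d1, \<not> snd d1)"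
      using attach.IH attach.prems by blast
    show ?thesis
    proof (cases "vert G d \<in> Y")
      case True
      let ?Y = "insert (dhead G d) Y"
      have "vert G (fst d, False) \<in> ?Y" "vert G (fst d, True) \<in> ?Y"
        using vends True by (metis insertCI insertE singletonD)+
      moreover have "vert G (h, False) \<in> ?Y \<longleftrightarrow> vert G (h, True) \<in> ?Y" if "h \<in> set es" "h \<noteq> e" for h
        using Y(3) that old[OF that(1)] by auto
      ultimately show ?thesis using uniq old[OF fes] Y(1,2)
        by (intro exI[of _ ?Y] exI[of _ d]) auto
    next
      case notY: False
      let ?Y = "Y - {dhead G d}"
      have d1n: "dhead G d1 \<noteq> dhead G d"
        using old[OF Y(4), of "\<not> snd d1"] by (simp add: dhead_def)
      have "vert G (fst d, False) \<notin> ?Y" "vert G (fst d, True) \<notin> ?Y"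
        using vends notY by (metis DiffE insert_iff singletonD)+
      moreover have "vert G (h, False) \<in> ?Y \<longleftrightarrow> vert G (h, True) \<in> ?Y" if "h \<in> set es" "h \<noteq> e" for h
        using Y(3) that old[OF that(1)] by auto
      moreover have "d' = (fst d1, \<not> snd d1)"
        if "fst d' \<in> set (fst d # es)" "vert G d' = dhead G d1" for d'
      proof (cases "fst d' = fst d")
        case True
        then have "vert G d' \<in> {vert G d, dhead G d}"
          using end_cases[OF True] by (auto simp: dhead_def)
        then show ?thesis using that(2) d1n notY Y(5) by auto
      next
        case False
        then show ?thesis using that Y(6) by (cases d') auto
      qed
      ultimately show ?thesis using Y d1n
        by (intro exI[of _ ?Y] exI[of _ d1]) auto
    qed
  qed
qed

section \<open>Eigenfunctions as classical solutions\<close>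

lemma nonneg_deriv_within_le:
  fixes f :: "real \<Rightarrow> real"
  assumes der: "\<And>x. x \<in> {0..l} \<Longrightarrow> (f has_real_derivative f' x) (at x within {0..l})"
    and pos: "\<And>x. x \<in> {0..l} \<Longrightarrow> 0 \<le> f' x" and ab: "0 \<le> a" "a \<le> b" "b \<le> l"
  shows "f a \<le> f b"
proof -
  have "\<exists>x\<in>{a..b}. f b - f a = f' x * (b - a)"
  proof (rule mvt_very_simple[OF ab(2)])
    fix x assume x: "a \<le> x" "x \<le> b"
    have "(f has_real_derivative f' x) (at x within {a..b})"
      using der[of x] x ab by (auto intro: DERIV_subset)
    then show "(f has_derivative (*) (f' x)) (at x within {a..b})"
      by (simp add: has_field_derivative_def)
  qed
  then obtain x where x: "x \<in> {a..b}" "f b - f a = f' x * (b - a)" by auto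
  have "0 \<le> f' x * (b - a)"
    using x ab pos[of x] by auto
  then show ?thesis using x(2) by linarith
qed

lemma deriv_within_unique:
  fixes f :: "real \<Rightarrow> real"
  assumes "0 < l" "x \<in> {0..l}" "(f has_real_derivative a) (at x within {0..l})"
    "(f has_real_derivative b) (at x within {0..l})"
  shows "a = b"
  using vector_derivative_unique_within_closed_interval[of 0 l x f a b] assms
  by (simp add: has_real_derivative_iff_has_vector_derivative)

lemma deriv_within_transform:
  fixes f :: "real \<Rightarrow> real"
  assumes "(f has_real_derivative a) (at x within S)" "x \<in> S" "\<And>y. y \<in> S \<Longrightarrow> g y = f y"
  shows "(g has_real_derivative a) (at x within S)"
  using assms has_derivative_transform[of x S g f] by (simp add: has_field_derivative_def)

lemma nonneg_deriv_within_zero: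
  fixes f :: "real \<Rightarrow> real"
  assumes l: "0 < l"
    and der: "\<And>x. x \<in> {0..l} \<Longrightarrow> (f has_real_derivative f' x) (at x within {0..l})"
    and pos: "\<And>x. x \<in> {0..l} \<Longrightarrow> 0 \<le> f' x" and le: "f l \<le> f 0" and x: "x \<in> {0..l}"
  shows "f' x = 0"
proof -
  have c: "f y = f 0" if "y \<in> {0..l}" for y
    using nonneg_deriv_within_le[OF der pos, of 0 y] nonneg_deriv_within_le[OF der pos, of y l] that le
    by auto
  have "(f has_real_derivative 0) (at x within {0..l})"
    by (rule deriv_within_transform[OF DERIV_const x c])
  then show ?thesis using deriv_within_unique[OF l x] der[OF x] by blast
qed

text \<open>
  For continuous \<open>q\<close> eigenfunctions are classical solutions of the eigenvalue equation, so that the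
  Sobolev functions and almost everywhere equalities in the definition of the operator can be
  replaced by two derivatives in the ordinary sense.
\<close>

definition solves :: "('e, 'v) metric_graph \<Rightarrow> 'e set \<Rightarrow> ('e \<Rightarrow> real \<Rightarrow> real) \<Rightarrow> real \<Rightarrow>
    ('e \<Rightarrow> real \<Rightarrow> real) \<Rightarrow> ('e \<Rightarrow> real \<Rightarrow> real) \<Rightarrow> bool" where
  "solves G S q \<mu> w w' \<longleftrightarrow> (\<forall>e\<in>S. \<forall>x\<in>{0..len G e}.
     (w e has_real_derivative w' e x) (at x within {0..len G e}) \<and>
     (w' e has_real_derivative (q e x - \<mu>) * w e x) (at x within {0..len G e}))"

text \<open>
  The flux into a subset \<open>S\<close> of the edges; the subsets are the partial trees of an inductive
  construction.
\<close>

definition flux :: "('e, 'v) metric_graph \<Rightarrow> 'e set \<Rightarrow> ('e \<Rightarrow> real \<Rightarrow> real) \<Rightarrow> 'v \<Rightarrow> real" where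
  "flux G S w' v = (\<Sum>d | fst d \<in> S \<and> vert G d = v. normal_deriv G w' d)"

lemma kirchhoff_iff_flux: "kirchhoff G w' \<longleftrightarrow> (\<forall>v\<in>vertices G. flux G (edges G) w' v = 0)"
proof -
  have "d \<in> ends G \<longleftrightarrow> fst d \<in> edges G" for d by (cases d) (auto simp: ends_def)
  then show ?thesis by (simp add: kirchhoff_def flux_def)
qed

definition classical :: "('e, 'v) metric_graph \<Rightarrow> ('e \<Rightarrow> real \<Rightarrow> real) \<Rightarrow> real \<Rightarrow>
    ('e \<Rightarrow> real \<Rightarrow> real) \<Rightarrow> ('e \<Rightarrow> real \<Rightarrow> real) \<Rightarrow> bool" where
  "classical G q \<mu> w w' \<longleftrightarrow> well_defined_on G w \<and> solves G (edges G) q \<mu> w w' \<and> kirchhoff G w'"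

lemma normal_deriv_zero: "normal_deriv G (\<lambda>_ _. 0) d = 0"
  by (simp add: normal_deriv_def)

lemma end_coord_mem:
  assumes "d \<in> ends G" "\<And>e. e \<in> edges G \<Longrightarrow> 0 < len G e"
  shows "end_coord G d \<in> {0..len G (fst d)}" "fst d \<in> edges G"
  using assms(2)[of "fst d"] assms(1) by (cases d, auto simp: end_coord_def ends_def)+

lemma classical_derivs:
  assumes "classical G q \<mu> w w'" "e \<in> edges G" "x \<in> {0..len G e}"
  shows "(w e has_real_derivative w' e x) (at x within {0..len G e})"
    "(w' e has_real_derivative (q e x - \<mu>) * w e x) (at x within {0..len G e})"
  using assms by (auto simp: classical_def solves_def)

lemma deriv_within_continuous:
  fixes f :: "real \<Rightarrow> real"
  assumes "\<And>x. x \<in> S \<Longrightarrow> (f has_real_derivative f' x) (at x within S)"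
  shows "continuous_on S f"
  using assms by (meson DERIV_continuous continuous_on_eq_continuous_within)

text \<open>
  The derivative of \<open>f\<close> is the indefinite integral of \<open>f''\<close>, and \<open>f''\<close> agrees up to a null set
  with a continuous function, which is therefore the derivative of \<open>f'\<close> everywhere.
\<close>

lemma H2_on_imp_classical:
  assumes H: "H2_on l f f' f''" and l: "0 < l" and q: "continuous_on {0..l} q"
    and ae: "AE x in lebesgue_on {0..l}. - f'' x + q x * f x = \<mu> * f x" and x: "x \<in> {0..l}"
  shows "(f' has_real_derivative (q x - \<mu>) * f x) (at x within {0..l})"
proof -
  let ?g = "\<lambda>x. (q x - \<mu>) * f x"
  have cf: "continuous_on {0..l} f"
    using H by (intro deriv_within_continuous[of _ _ f']) (auto simp: H2_on_def)
  have cg: "continuous_on {0..l} ?g" by (intro continuous_intros q cf)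
  have "AE x in lebesgue. x \<in> {0..l} \<longrightarrow> f'' x = ?g x"
  proof -
    have "AE x in lebesgue. x \<in> {0..l} \<longrightarrow> - f'' x + q x * f x = \<mu> * f x"
      using ae by (subst (asm) AE_restrict_space_iff) auto
    then show ?thesis by eventually_elim (auto simp: algebra_simps)
  qed
  then obtain N where N: "N \<in> null_sets lebesgue" "{x. \<not> (x \<in> {0..l} \<longrightarrow> f'' x = ?g x)} \<subseteq> N"
    by (auto simp: eventually_ae_filter)
  have negN: "negligible N" using N(1) by (simp add: negligible_iff_null_sets)
  have int: "integral {0..y} ?g = f' y - f' 0" if y: "y \<in> {0..l}" for y
  proof (rule integral_unique, rule has_integral_spike[OF negN])
    show "?g t = f'' t" if "t \<in> {0..y} - N" for t using N(2) that y by auto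
    show "(f'' has_integral f' y - f' 0) {0..y}" using H y by (auto simp: H2_on_def)
  qed
  have "((\<lambda>y. f' 0 + integral {0..y} ?g) has_real_derivative ?g x) (at x within {0..l})"
    using DERIV_add[OF DERIV_const integral_has_real_derivative[OF cg x], of "f' 0"] by simp
  then show ?thesis
    by (rule deriv_within_transform) (use int x in auto)
qed

lemma classical_imp_H2_on:
  assumes l: "0 < l" and q: "continuous_on {0..l} q"
    and f: "\<And>x. x \<in> {0..l} \<Longrightarrow> (f has_real_derivative f' x) (at x within {0..l})"
    and f': "\<And>x. x \<in> {0..l} \<Longrightarrow> (f' has_real_derivative (q x - \<mu>) * f x) (at x within {0..l})"
  shows "H2_on l f f' (\<lambda>x. (q x - \<mu>) * f x)"
proof -
  let ?g = "\<lambda>x. (q x - \<mu>) * f x"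
  have cg: "continuous_on {0..l} ?g"
    by (intro continuous_intros q deriv_within_continuous[of _ f f'] f)
  have "(?g has_integral (f' x - f' 0)) {0..x}" if x: "x \<in> {0..l}" for x
  proof (rule fundamental_theorem_of_calculus)
    show "0 \<le> x" using x by auto
    show "(f' has_vector_derivative ?g t) (at t within {0..x})" if "t \<in> {0..x}" for t
      using f'[of t] that x
      by (auto simp: has_real_derivative_iff_has_vector_derivative[symmetric] intro: DERIV_subset)
  qed
  moreover have "?g \<in> borel_measurable (lebesgue_on {0..l})"
    by (intro continuous_imp_measurable_on_sets_lebesgue cg) auto
  moreover have "integrable (lebesgue_on {0..l}) (\<lambda>x. (?g x)\<^sup>2)"
    by (intro continuous_imp_integrable_real continuous_on_power cg)
  ultimately show ?thesis using f by (auto simp: H2_on_def)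
qed

lemma schroedinger_iff_classical:
  assumes len: "\<And>e. e \<in> edges G \<Longrightarrow> 0 < len G e"
    and q: "\<And>e. e \<in> edges G \<Longrightarrow> continuous_on {0..len G e} (q e)"
  shows "schroedinger G q w (\<lambda>e x. \<mu> * w e x) \<longleftrightarrow> (\<exists>w'. classical G q \<mu> w w')"
proof
  assume "schroedinger G q w (\<lambda>e x. \<mu> * w e x)"
  then obtain w' w'' where w: "well_defined_on G w" "kirchhoff G w'"
      "\<And>e. e \<in> edges G \<Longrightarrow> H2_on (len G e) (w e) (w' e) (w'' e)"
      "\<And>e. e \<in> edges G \<Longrightarrow> AE x in lebesgue_on {0..len G e}. - w'' e x + q e x * w e x = \<mu> * w e x"
    by (auto simp: schroedinger_def)
  have "solves G (edges G) q \<mu> w w'"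
    unfolding solves_def using H2_on_imp_classical[OF w(3) len q w(4)] w(3) by (auto simp: H2_on_def)
  then show "\<exists>w'. classical G q \<mu> w w'" using w by (auto simp: classical_def)
next
  assume "\<exists>w'. classical G q \<mu> w w'"
  then obtain w' where w': "classical G q \<mu> w w'" by auto
  have H: "H2_on (len G e) (w e) (w' e) (\<lambda>x. (q e x - \<mu>) * w e x)" if "e \<in> edges G" for e
    using classical_imp_H2_on[OF len[OF that] q[OF that] classical_derivs[OF w' that]] .
  show "schroedinger G q w (\<lambda>e x. \<mu> * w e x)"
    unfolding schroedinger_def
  proof (intro conjI exI ballI)
    show "well_defined_on G w" "kirchhoff G w'" using w' by (auto simp: classical_def)
    show "H2_on (len G e) (w e) (w' e) ((\<lambda>e x. (q e x - \<mu>) * w e x) e)" if "e \<in> edges G" for e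
      using H[OF that] by simp
    show "AE x in lebesgue_on {0..len G e}. - ((q e x - \<mu>) * w e x) + q e x * w e x = \<mu> * w e x" for e
      by (simp add: algebra_simps)
  qed
qed

section \<open>A positive eigenfunction lies at the bottom of the spectrum\<close>

text \<open>
  Picone's identity: the function \<open>F\<close> has the derivative
  \<open>(w' - w \<phi>' / \<phi>)\<^sup>2 + (\<mu> - \<nu>) w\<^sup>2\<close>, which is nonnegative. The potential has cancelled. If the boundary
  terms do not grow, both summands vanish.
\<close>

lemma picone_edge:
  fixes w w' \<phi> \<phi>' :: "real \<Rightarrow> real"
  defines "F \<equiv> \<lambda>x. w x * w' x - (w x)\<^sup>2 * \<phi>' x / \<phi> x"
  assumes l: "0 < l" and \<nu>: "\<nu> \<le> \<mu>"
    and w: "\<And>x. x \<in> {0..l} \<Longrightarrow> (w has_real_derivative w' x) (at x within {0..l})"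
      "\<And>x. x \<in> {0..l} \<Longrightarrow> (w' has_real_derivative (q x - \<nu>) * w x) (at x within {0..l})"
    and \<phi>: "\<And>x. x \<in> {0..l} \<Longrightarrow> (\<phi> has_real_derivative \<phi>' x) (at x within {0..l})"
      "\<And>x. x \<in> {0..l} \<Longrightarrow> (\<phi>' has_real_derivative (q x - \<mu>) * \<phi> x) (at x within {0..l})"
    and pos: "\<And>x. x \<in> {0..l} \<Longrightarrow> 0 < \<phi> x"
  shows "F 0 \<le> F l"
    and "F l \<le> F 0 \<Longrightarrow> x \<in> {0..l} \<Longrightarrow> (\<mu> - \<nu>) * (w x)\<^sup>2 = 0 \<and> w' x = w x * \<phi>' x / \<phi> x"
proof -
  let ?F' = "\<lambda>x. (w' x - w x * \<phi>' x / \<phi> x)\<^sup>2 + (\<mu> - \<nu>) * (w x)\<^sup>2"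
  have F': "(F has_real_derivative ?F' x) (at x within {0..l})" if x: "x \<in> {0..l}" for x
  proof -
    have ne: "\<phi> x \<noteq> 0" using pos[OF x] by simp
    note D = DERIV_diff[OF DERIV_mult[OF w(1)[OF x] w(2)[OF x]]
        DERIV_divide[OF DERIV_mult[OF DERIV_power[OF w(1)[OF x], of 2] \<phi>(2)[OF x]] \<phi>(1)[OF x] ne]]
    show ?thesis unfolding F_def
      by (rule DERIV_cong[OF D])
         (use ne in \<open>simp add: divide_simps power2_eq_square, simp add: algebra_simps\<close>)
  qed
  have nn: "0 \<le> ?F' x" for x using \<nu> by simp
  show "F 0 \<le> F l" using nonneg_deriv_within_le[OF F' nn, of 0 l] l by auto
  assume "F l \<le> F 0" "x \<in> {0..l}"
  then have "?F' x = 0" using nonneg_deriv_within_zero[OF l F' nn] by blast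
  moreover have "0 \<le> (w' x - w x * \<phi>' x / \<phi> x)\<^sup>2" "0 \<le> (\<mu> - \<nu>) * (w x)\<^sup>2" using \<nu> by auto
  ultimately have "(w' x - w x * \<phi>' x / \<phi> x)\<^sup>2 = 0 \<and> (\<mu> - \<nu>) * (w x)\<^sup>2 = 0" by linarith
  then show "(\<mu> - \<nu>) * (w x)\<^sup>2 = 0 \<and> w' x = w x * \<phi>' x / \<phi> x" by auto
qed

definition at_end :: "('e, 'v) metric_graph \<Rightarrow> ('e \<Rightarrow> real \<Rightarrow> real) \<Rightarrow> 'e \<times> bool \<Rightarrow> real" where
  "at_end G f d = f (fst d) (end_coord G d)"

lemma well_defined_at_end:
  "well_defined_on G f \<Longrightarrow> d \<in> ends G \<Longrightarrow> d' \<in> ends G \<Longrightarrow> vert G d = vert G d' \<Longrightarrow> at_end G f d = at_end G f d'"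
  unfolding well_defined_on_def at_end_def by blast

text \<open>
  Grouping the ends by vertices, the common factor \<open>c\<close> can be pulled out of each Kirchhoff sum.
\<close>

lemma sum_ends_kirchhoff:
  assumes fin: "finite (edges G)" and k: "kirchhoff G w'"
    and c: "\<And>d d'. d \<in> ends G \<Longrightarrow> d' \<in> ends G \<Longrightarrow> vert G d = vert G d' \<Longrightarrow> c d = c d'"
  shows "(\<Sum>d\<in>ends G. c d * normal_deriv G w' d) = 0"
proof -
  have fe: "finite (ends G)" using fin by (simp add: ends_def)
  have "(\<Sum>d\<in>ends G. c d * normal_deriv G w' d)
      = (\<Sum>v\<in>vertices G. \<Sum>d\<in>{d \<in> ends G. vert G d = v}. c d * normal_deriv G w' d)"
    by (rule sum.group[symmetric]) (use fe in \<open>auto simp: vertices_def\<close>)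
  also have "\<dots> = 0"
  proof (rule sum.neutral, rule ballI)
    fix v assume v: "v \<in> vertices G"
    then obtain d0 where d0: "d0 \<in> ends G" "vert G d0 = v" by (auto simp: vertices_def)
    have "(\<Sum>d\<in>{d \<in> ends G. vert G d = v}. c d * normal_deriv G w' d)
        = (\<Sum>d\<in>{d \<in> ends G. vert G d = v}. c d0 * normal_deriv G w' d)"
    proof (rule sum.cong[OF refl])
      fix d assume "d \<in> {d \<in> ends G. vert G d = v}"
      then have "c d = c d0" using c[of d d0] d0 by auto
      then show "c d * normal_deriv G w' d = c d0 * normal_deriv G w' d" by simp
    qed
    also have "\<dots> = 0" using k v by (simp add: kirchhoff_def flip: sum_distrib_left)
    finally show "(\<Sum>d\<in>{d \<in> ends G. vert G d = v}. c d * normal_deriv G w' d) = 0" .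
  qed
  finally show ?thesis .
qed

text \<open>
  By the Kirchhoff conditions the boundary terms of Picone's identity add up to \<open>0\<close> over the whole
  graph, while each edge contributes a nonnegative amount. Hence every edge contributes \<open>0\<close>.
\<close>

lemma ground_state_comparison:
  assumes fin: "finite (edges G)" and len: "\<And>e. e \<in> edges G \<Longrightarrow> 0 < len G e"
    and \<phi>: "classical G q \<mu> \<phi> \<phi>'" and pos: "\<And>e x. e \<in> edges G \<Longrightarrow> x \<in> {0..len G e} \<Longrightarrow> 0 < \<phi> e x"
    and w: "classical G q \<nu> w w'" and \<nu>: "\<nu> \<le> \<mu>" and e: "e \<in> edges G" and x: "x \<in> {0..len G e}"
  shows "(\<mu> - \<nu>) * (w e x)\<^sup>2 = 0" "w' e x = w e x * \<phi>' e x / \<phi> e x"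
proof -
  let ?F = "\<lambda>e x. w e x * w' e x - (w e x)\<^sup>2 * \<phi>' e x / \<phi> e x"
  let ?W = "at_end G w" and ?P = "at_end G \<phi>"
  have wd: "?W d = ?W d'" "?P d = ?P d'" if "d \<in> ends G" "d' \<in> ends G" "vert G d = vert G d'" for d d'
    using well_defined_at_end that \<phi> w unfolding classical_def by blast+
  have mono: "?F e 0 \<le> ?F e (len G e)" if e: "e \<in> edges G" for e
    using picone_edge(1)[OF len[OF e] \<nu> classical_derivs[OF w e] classical_derivs[OF \<phi> e] pos[OF e]] .
  have "(\<Sum>e\<in>edges G. ?F e 0 - ?F e (len G e))
      = (\<Sum>e\<in>edges G. \<Sum>b\<in>UNIV. ?W (e, b) * normal_deriv G w' (e, b)
          - (?W (e, b))\<^sup>2 / ?P (e, b) * normal_deriv G \<phi>' (e, b))"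
    by (intro sum.cong refl) (simp add: UNIV_bool at_end_def normal_deriv_def end_coord_def)
  also have "\<dots> = (\<Sum>d\<in>ends G. ?W d * normal_deriv G w' d - (?W d)\<^sup>2 / ?P d * normal_deriv G \<phi>' d)"
    by (simp add: ends_def sum.cartesian_product)
  also have "\<dots> = (\<Sum>d\<in>ends G. ?W d * normal_deriv G w' d) - (\<Sum>d\<in>ends G. (?W d)\<^sup>2 / ?P d * normal_deriv G \<phi>' d)"
    by (rule sum_subtractf)
  also have "(\<Sum>d\<in>ends G. ?W d * normal_deriv G w' d) = 0"
    by (rule sum_ends_kirchhoff[OF fin _ wd(1)]) (use w in \<open>simp add: classical_def\<close>)
  also have "(\<Sum>d\<in>ends G. (?W d)\<^sup>2 / ?P d * normal_deriv G \<phi>' d) = 0"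
  proof (rule sum_ends_kirchhoff[OF fin])
    show "kirchhoff G \<phi>'" using \<phi> by (simp add: classical_def)
    show "(?W d)\<^sup>2 / ?P d = (?W d')\<^sup>2 / ?P d'"
      if "d \<in> ends G" "d' \<in> ends G" "vert G d = vert G d'" for d d'
      using wd[OF that] by simp
  qed
  finally have "(\<Sum>e\<in>edges G. ?F e (len G e) - ?F e 0) = 0"
    by (simp add: sum_subtractf)
  then have "?F e (len G e) - ?F e 0 = 0"
    using sum_nonneg_eq_0_iff[OF fin, of "\<lambda>e. ?F e (len G e) - ?F e 0"] mono e by force
  then have "?F e (len G e) \<le> ?F e 0" by linarith
  from picone_edge(2)[OF len[OF e] \<nu> classical_derivs[OF w e] classical_derivs[OF \<phi> e] pos[OF e] this x]
  show "(\<mu> - \<nu>) * (w e x)\<^sup>2 = 0" "w' e x = w e x * \<phi>' e x / \<phi> e x" by blast+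
qed

section \<open>Solutions on a single edge\<close>

text \<open>
  The equation \<open>F'' = - \<mu> F\<close> on an edge, in terms of the distance from the endpoint where the edge is
  attached. The far end carries the Robin condition \<open>F' l = c F l\<close>, which stands for the branches
  beyond it. At the near end these branches and the edge together act like a Robin condition with
  the coefficient \<open>F' 0\<close>. The point is that this coefficient is again nonnegative and of order \<open>\<mu>\<close>,
  so that the estimate can be iterated.
\<close>

lemma attached_edge_solution:
  fixes l K :: real
  assumes l: "0 < l" and K: "0 \<le> K"
  shows "\<exists>\<delta>>0. \<forall>\<mu> c. 0 < \<mu> \<and> \<mu> \<le> \<delta> \<and> 0 \<le> c \<and> c \<le> K * \<mu> \<longrightarrow>
    (\<exists>F F'. (\<forall>z. (F has_real_derivative F' z) (at z) \<and> (F' has_real_derivative - \<mu> * F z) (at z))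
      \<and> (\<forall>z\<in>{0..l}. 0 < F z) \<and> F 0 = 1 \<and> F' l = c * F l \<and> 0 \<le> F' 0 \<and> F' 0 \<le> 2 * (l + K) * \<mu>)"
proof -
  define \<delta> where "\<delta> = 1 / (l\<^sup>2 + 2 * K * l)"
  have den: "0 < l\<^sup>2 + 2 * K * l" using l K by (simp add: add_pos_nonneg)
  have "\<delta> > 0" using den by (simp add: \<delta>_def)
  moreover have "\<exists>F F'. (\<forall>z. (F has_real_derivative F' z) (at z) \<and> (F' has_real_derivative - \<mu> * F z) (at z))
      \<and> (\<forall>z\<in>{0..l}. 0 < F z) \<and> F 0 = 1 \<and> F' l = c * F l \<and> 0 \<le> F' 0 \<and> F' 0 \<le> 2 * (l + K) * \<mu>"
    if \<mu>: "0 < \<mu>" "\<mu> \<le> \<delta>" and c: "0 \<le> c" "c \<le> K * \<mu>" for \<mu> c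
  proof -
    define k where "k = sqrt \<mu>"
    have k: "0 < k" "k * k = \<mu>" using \<mu> by (simp_all add: k_def)
    \<comment> \<open>The solution in terms of the distance \<open>y\<close> from the far end; normalising it at \<open>y = l\<close> gives \<open>F\<close>.\<close>
    define p where "p y = cos (k * y) - c / k * sin (k * y)" for y
    define p' where "p' y = - k * sin (k * y) - c * cos (k * y)" for y
    have dp: "(p has_real_derivative p' y) (at y)" for y
      unfolding p_def p'_def by (rule derivative_eq_intros refl | simp)+ (use k(1) in \<open>simp add: field_simps\<close>)
    have dp': "(p' has_real_derivative - \<mu> * p y) (at y)" for y
      unfolding p_def p'_def k(2)[symmetric]
      by (rule derivative_eq_intros refl | simp)+ (use k(1) in \<open>simp add: field_simps\<close>)
    have small: "\<mu> * (l\<^sup>2 + 2 * K * l) \<le> 1"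
      using \<mu> den by (simp add: \<delta>_def field_simps)
    have cos_ge: "1 - (k * y)\<^sup>2 / 2 \<le> cos (k * y)" for y
    proof -
      have "cos (k * y) = 1 - 2 * (sin (k * y / 2))\<^sup>2"
        using cos_double_sin[of "k * y / 2"] by simp
      moreover have "(sin (k * y / 2))\<^sup>2 \<le> (k * y / 2)\<^sup>2"
        using abs_sin_x_le_abs_x[of "k * y / 2"] by (simp only: abs_le_square_iff)
      ultimately show ?thesis by (simp add: power_divide)
    qed
    have ky: "(k * y)\<^sup>2 \<le> \<mu> * l\<^sup>2" if "y \<in> {0..l}" for y
    proof -
      have "y\<^sup>2 \<le> l\<^sup>2" using that by (intro power_mono) auto
      then show ?thesis using k \<mu>(1) by (simp add: power_mult_distrib power2_eq_square[of k])
    qed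
    have half: "1 / 2 \<le> p y" and cos_nn: "0 \<le> cos (k * y)" if y: "y \<in> {0..l}" for y
    proof -
      have "c / k * sin (k * y) \<le> c / k * (k * y)"
        using y k c by (intro mult_left_mono sin_x_le_x) auto
      also have "\<dots> = c * y" using k by simp
      also have "\<dots> \<le> K * \<mu> * l" using y c K \<mu> by (intro mult_mono) auto
      finally have "c / k * sin (k * y) \<le> K * \<mu> * l" .
      then show "1 / 2 \<le> p y"
        using cos_ge[of y] ky[OF y] small unfolding p_def by (simp add: algebra_simps)
      have "0 \<le> \<mu> * (2 * K * l)" using \<mu> K l by simp
      then show "0 \<le> cos (k * y)"
        using cos_ge[of y] ky[OF y] small by (simp add: algebra_simps)
    qed
    define F where "F z = p (l - z) / p l" for z
    define F' where "F' z = - p' (l - z) / p l" for z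
    have pl: "1 / 2 \<le> p l" "p l \<noteq> 0" using half[of l] l by auto
    have flip: "((\<lambda>z. l - z) has_real_derivative - 1) (at z)" for z
      by (auto intro!: derivative_eq_intros)
    have dF: "(F has_real_derivative F' z) (at z)" for z
      unfolding F_def F'_def using DERIV_cdivide[OF DERIV_chain2[OF dp flip], where c = "p l"] by simp
    have dF': "(F' has_real_derivative - \<mu> * F z) (at z)" for z
      unfolding F_def F'_def
      using DERIV_cdivide[OF DERIV_minus[OF DERIV_chain2[OF dp' flip]], where c = "p l"] by simp
    have "0 < F z" if "z \<in> {0..l}" for z
      using half[of "l - z"] that pl(1) unfolding F_def by (intro divide_pos_pos) auto
    moreover have "F 0 = 1" using pl by (simp add: F_def)
    moreover have "F' l = c * F l" by (simp add: F_def F'_def p_def p'_def)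
    moreover have "0 \<le> F' 0 \<and> F' 0 \<le> 2 * (l + K) * \<mu>"
    proof -
      have kl1: "(k * l)\<^sup>2 \<le> 1"
      proof -
        have "0 \<le> \<mu> * (2 * K * l)" using \<mu> K l by simp
        then have "\<mu> * l\<^sup>2 \<le> 1" using small unfolding distrib_left by linarith
        moreover have "(k * l)\<^sup>2 \<le> \<mu> * l\<^sup>2" using ky[of l] l by simp
        ultimately show ?thesis by linarith
      qed
      have "k * l \<le> 1" using kl1 by (simp add: power_le_one_iff abs_square_le_1 abs_le_iff)
      then have "k * l \<le> pi" using pi_gt3 by linarith
      then have s: "0 \<le> sin (k * l)" using k l by (intro sin_ge_zero) auto
      have N0: "0 \<le> - p' l"
        using s k c cos_nn[of l] l unfolding p'_def by simp
      have "k * sin (k * l) \<le> k * (k * l)"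
        using k l by (intro mult_left_mono sin_x_le_x) auto
      also have "\<dots> = \<mu> * l" by (simp flip: k(2))
      finally have "k * sin (k * l) \<le> \<mu> * l" .
      moreover have "c * cos (k * l) \<le> K * \<mu> * 1"
        using c K \<mu> by (intro mult_mono) (auto simp: cos_nn l less_imp_le)
      ultimately have N1: "- p' l \<le> (l + K) * \<mu>"
        by (simp add: p'_def algebra_simps)
      have "- p' l / p l \<le> - p' l / (1 / 2)"
        using N0 pl by (intro divide_left_mono) auto
      also have "\<dots> = 2 * (- p' l)" by simp
      also have "\<dots> \<le> 2 * ((l + K) * \<mu>)" using N1 by (intro mult_left_mono) auto
      finally have "- p' l / p l \<le> 2 * ((l + K) * \<mu>)" .
      moreover have "0 \<le> - p' l / p l" using N0 pl by (intro divide_nonneg_nonneg) auto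
      moreover have "F' 0 = - p' l / p l" by (simp add: F'_def)
      ultimately show ?thesis by (simp only: mult.assoc)
    qed
    ultimately show ?thesis using dF dF' by blast
  qed
  ultimately show ?thesis by blast
qed

text \<open>
  A profile describes a potential on a leaf edge as a function of the distance \<open>z\<close> from the inner
  endpoint. It vanishes for \<open>z \<le> 0\<close>, hence its restriction to \<open>z \<le> l\<close> also describes the potential
  on every path that ends with this edge.
\<close>

definition profile :: "real \<Rightarrow> real \<Rightarrow> (real \<Rightarrow> real) \<Rightarrow> bool" where
  "profile l M Q \<longleftrightarrow> convex_on {..l} Q \<and> continuous_on {0..l} Q \<and> (\<forall>z\<le>0. Q z = 0)
     \<and> (\<forall>z\<le>l. 0 \<le> Q z \<and> Q z \<le> M)"

text \<open>
  A convex and increasing function composed with the convex function \<open>z \<mapsto> max z 0\<close>.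
\<close>

lemma convex_on_extend_zero:
  fixes H :: "real \<Rightarrow> real"
  assumes cv: "convex_on {0..l} H" and l: "0 < l"
    and mono: "\<And>x y. 0 \<le> x \<Longrightarrow> x \<le> y \<Longrightarrow> y \<le> l \<Longrightarrow> H x \<le> H y"
  shows "convex_on {..l} (\<lambda>z. H (max z 0))"
proof (rule convex_onI)
  fix t x y :: real
  assume t: "0 < t" "t < 1" and xy: "x \<in> {..l}" "y \<in> {..l}"
  let ?x = "max x 0" and ?y = "max y 0"
  have mem: "?x \<in> {0..l}" "?y \<in> {0..l}" using xy l by auto
  have lower: "(1 - t) * x + t * y \<le> (1 - t) * ?x + t * ?y"
    using t by (intro add_mono mult_left_mono) auto
  have nonneg: "0 \<le> (1 - t) * ?x + t * ?y"
    using t by auto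
  have "(1 - t) * ?x + t * ?y \<le> (1 - t) * l + t * l"
    using t mem by (intro add_mono mult_left_mono) auto
  then have upper: "(1 - t) * ?x + t * ?y \<le> l" by (simp add: algebra_simps)
  have "H (max ((1 - t) * x + t * y) 0) \<le> H ((1 - t) * ?x + t * ?y)"
    by (rule mono[OF _ max.boundedI[OF lower nonneg] upper]) simp
  also have "\<dots> \<le> (1 - t) * H ?x + t * H ?y"
    using convex_onD[OF cv, of t ?x ?y] mem t by auto
  finally show "H (max ((1 - t) *\<^sub>R x + t *\<^sub>R y) 0) \<le> (1 - t) * H ?x + t * H ?y"
    by simp
qed auto

text \<open>
  The potential is reconstructed from the solution. A positive function \<open>F\<close> with \<open>F' = - g F\<close>
  satisfies \<open>F'' = (g\<^sup>2 - g') F\<close>, so it solves the eigenvalue equation for the potential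
  \<open>H = \<mu> + g\<^sup>2 - g'\<close>. The conditions \<open>F' 0 = - c\<close>, \<open>F' l = 0\<close> and \<open>H 0 = 0\<close> say that \<open>g 0 = c\<close>, \<open>g l = 0\<close>
  and \<open>g' 0 = \<mu> + c\<^sup>2\<close>, and they are met by \<open>g z = (c + E z) (1 - z\<^sup>2 / l\<^sup>2)\<close> with \<open>E = \<mu> + c\<^sup>2\<close>. In the second
  derivative of \<open>H\<close> minus the third derivative of \<open>g\<close> contributes the positive constant \<open>6 E / l\<^sup>2\<close>, of first order in \<open>\<mu>\<close>, whereas
  the negative contributions of \<open>g\<^sup>2\<close> are of second order. Hence \<open>H\<close> is convex for small \<open>\<mu>\<close>.
\<close>

lemma leaf_edge_solution:
  fixes l K M :: real
  assumes l: "0 < l" and K: "0 \<le> K" and M: "0 < M"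
  shows "\<exists>\<delta>>0. \<forall>\<mu> c. 0 < \<mu> \<and> \<mu> \<le> \<delta> \<and> 0 \<le> c \<and> c \<le> K * \<mu> \<longrightarrow>
    (\<exists>Q F F' F''. profile l M Q
      \<and> (\<forall>z. (F has_real_derivative F' z) (at z) \<and> (F' has_real_derivative F'' z) (at z))
      \<and> (\<forall>z\<in>{0..l}. F'' z = (Q z - \<mu>) * F z) \<and> (\<forall>z. 0 < F z)
      \<and> F 0 = 1 \<and> F' 0 = - c \<and> F' l = 0)"
proof -
  define B where "B = K + l"
  define \<delta> where "\<delta> = min 1 (min (1 / (2 * B\<^sup>2 * (1 + K\<^sup>2))) (M / ((3 + 2 * K / l) * (1 + K\<^sup>2))))"
  have B: "0 < B" using l K by (simp add: B_def)
  have K2: "0 < 1 + K\<^sup>2" using zero_le_power2[of K] by linarith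
  have K3: "0 < 3 + 2 * K / l" using l K by (simp add: add_pos_nonneg)
  have "\<delta> > 0" using B K2 K3 M by (simp add: \<delta>_def)
  moreover have "\<exists>Q F F' F''. profile l M Q
      \<and> (\<forall>z. (F has_real_derivative F' z) (at z) \<and> (F' has_real_derivative F'' z) (at z))
      \<and> (\<forall>z\<in>{0..l}. F'' z = (Q z - \<mu>) * F z) \<and> (\<forall>z. 0 < F z)
      \<and> F 0 = 1 \<and> F' 0 = - c \<and> F' l = 0"
    if \<mu>: "0 < \<mu>" "\<mu> \<le> \<delta>" and c: "0 \<le> c" "c \<le> K * \<mu>" for \<mu> c
  proof -
    define E where "E = \<mu> + c\<^sup>2"
    define i where "i = 1 / l\<^sup>2"
    define g where "g z = (c + E * z) * (1 - i * z\<^sup>2)" for z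
    define g' where "g' z = E - 2 * i * c * z - 3 * i * E * z\<^sup>2" for z
    define g'' where "g'' z = - 2 * i * c - 6 * i * E * z" for z
    \<comment> \<open>The antiderivative of \<open>- g\<close> that vanishes at \<open>0\<close>.\<close>
    define P where "P z = - c * z - E / 2 * z\<^sup>2 + i * c / 3 * z ^ 3 + i * E / 4 * z ^ 4" for z
    define H where "H z = \<mu> + (g z)\<^sup>2 - g' z" for z
    define H' where "H' z = 2 * g z * g' z - g'' z" for z
    define H'' where "H'' z = 2 * (g' z)\<^sup>2 + 2 * g z * g'' z + 6 * i * E" for z
    define Q where "Q z = H (max z 0)" for z
    have i: "0 < i" "i * l\<^sup>2 = 1" using l by (simp_all add: i_def)
    have dg: "(g has_real_derivative g' z) (at z)" for z
      unfolding g_def g'_def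
      by (auto intro!: derivative_eq_intros simp: algebra_simps power2_eq_square)
    have dg': "(g' has_real_derivative g'' z) (at z)" for z
      unfolding g'_def g''_def
      by (auto intro!: derivative_eq_intros simp: algebra_simps power2_eq_square)
    have dg'': "(g'' has_real_derivative - 6 * i * E) (at z)" for z
      unfolding g''_def
      by (auto intro!: derivative_eq_intros simp: algebra_simps)
    have dP: "(P has_real_derivative - g z) (at z)" for z
      unfolding P_def g_def
      by (auto intro!: derivative_eq_intros simp: algebra_simps power2_eq_square power3_eq_cube)
    have dH: "(H has_real_derivative H' z) (at z)" for z
      unfolding H_def H'_def
      by (rule DERIV_cong[OF DERIV_diff[OF DERIV_add[OF DERIV_const DERIV_power[OF dg]] dg']]) simp
    have dH': "(H' has_real_derivative H'' z) (at z)" for z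
      unfolding H'_def
      by (rule DERIV_cong[OF DERIV_diff[OF DERIV_mult[OF DERIV_cmult[OF dg] dg'] dg'']])
         (simp add: H''_def power2_eq_square algebra_simps)
    have mu1: "\<mu> \<le> 1" and mu2: "\<mu> * (2 * B\<^sup>2 * (1 + K\<^sup>2)) \<le> 1"
      and mu3: "\<mu> * ((3 + 2 * K / l) * (1 + K\<^sup>2)) \<le> M"
    proof -
      have "\<mu> \<le> 1 / (2 * B\<^sup>2 * (1 + K\<^sup>2))" "\<mu> \<le> M / ((3 + 2 * K / l) * (1 + K\<^sup>2))" "\<mu> \<le> 1"
        using \<mu> by (auto simp: \<delta>_def)
      then show "\<mu> \<le> 1" "\<mu> * (2 * B\<^sup>2 * (1 + K\<^sup>2)) \<le> 1" "\<mu> * ((3 + 2 * K / l) * (1 + K\<^sup>2)) \<le> M"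
        using B K2 K3 by (simp_all only: pos_le_divide_eq mult_pos_pos zero_less_power zero_less_numeral)
    qed
    have E: "0 < E" "\<mu> \<le> E" using \<mu> by (auto simp: E_def add_pos_nonneg)
    have Ele: "E \<le> \<mu> * (1 + K\<^sup>2)"
    proof -
      have "c\<^sup>2 \<le> (K * \<mu>)\<^sup>2" using c by (intro power_mono) auto
      also have "\<dots> = \<mu> * K\<^sup>2 * \<mu>" by (simp add: power2_eq_square)
      also have "\<dots> \<le> \<mu> * K\<^sup>2 * 1" using mu1 \<mu> by (intro mult_left_mono) auto
      finally show ?thesis by (simp add: E_def algebra_simps)
    qed
    have cE: "c \<le> K * E" using c E K by (meson mult_left_mono order_trans)
    have EB: "2 * B\<^sup>2 * E \<le> 1"
    proof -
      have "2 * B\<^sup>2 * E \<le> 2 * B\<^sup>2 * (\<mu> * (1 + K\<^sup>2))" using Ele by (intro mult_left_mono) auto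
      then show ?thesis using mu2 by (simp add: mult.assoc mult.left_commute)
    qed
    have EM: "E * (3 + 2 * K / l) \<le> M"
    proof -
      have "E * (3 + 2 * K / l) \<le> \<mu> * (1 + K\<^sup>2) * (3 + 2 * K / l)"
        using Ele K3 by (intro mult_right_mono) auto
      also have "\<dots> = \<mu> * ((3 + 2 * K / l) * (1 + K\<^sup>2))" by (simp only: ac_simps)
      finally show ?thesis using mu3 by linarith
    qed
    have H''_nn: "0 \<le> H'' z" if z: "z \<in> {0..l}" for z
    proof -
      have "i * z\<^sup>2 \<le> i * l\<^sup>2" using z i by (intro mult_left_mono power_mono) auto
      then have ratio: "0 \<le> 1 - i * z\<^sup>2" "1 - i * z\<^sup>2 \<le> 1"
        using i by auto
      have Ez: "0 \<le> E * z" "E * z \<le> E * l" using z E by auto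
      have cl: "c + E * l \<le> B * E" using cE by (simp add: B_def algebra_simps)
      have g_nn: "0 \<le> g z" unfolding g_def using ratio Ez c by (intro mult_nonneg_nonneg) auto
      have "g z \<le> (c + E * z) * 1" unfolding g_def using ratio Ez c by (intro mult_left_mono) auto
      also have "\<dots> \<le> c + E * l" using Ez by simp
      finally have g_le: "g z \<le> B * E" using cl by (rule order_trans)
      have "i * (2 * c + 6 * (E * z)) \<le> i * (6 * (B * E))"
        using cl Ez c i by (intro mult_left_mono) linarith+
      then have g''_le: "- g'' z \<le> i * (6 * (B * E))"
        unfolding g''_def by (simp add: algebra_simps)
      have g''_nn: "0 \<le> - g'' z"
        unfolding g''_def using Ez c i by (simp add: mult.assoc)
      have "g z * (- g'' z) \<le> (B * E) * (i * (6 * (B * E)))"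
        using g_nn g_le g''_le g''_nn by (intro mult_mono) linarith+
      also have "\<dots> = (2 * B\<^sup>2 * E) * (3 * i * E)"
        by (simp add: power2_eq_square)
      also have "\<dots> \<le> 1 * (3 * i * E)" using EB E i by (intro mult_right_mono) auto
      finally have "2 * (g z * (- g'' z)) \<le> 6 * i * E" by linarith
      moreover have "2 * g z * g'' z = - (2 * (g z * (- g'' z)))" by simp
      ultimately show ?thesis unfolding H''_def using zero_le_power2[of "g' z"] by linarith
    qed
    have H'_mono: "H' x \<le> H' y" if "0 \<le> x" "x \<le> y" "y \<le> l" for x y
      by (rule DERIV_nonneg_imp_nondecreasing[OF that(2)])
         (use dH' H''_nn that in \<open>meson atLeastAtMost_iff order_trans\<close>)
    have H'_nn: "0 \<le> H' z" if "0 \<le> z" "z \<le> l" for z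
    proof -
      have "0 \<le> H' 0" unfolding H'_def g_def g'_def g''_def using c E i by simp
      then show ?thesis using H'_mono[of 0 z] that by simp
    qed
    have H_mono: "H x \<le> H y" if "0 \<le> x" "x \<le> y" "y \<le> l" for x y
      by (rule DERIV_nonneg_imp_nondecreasing[OF that(2)])
         (use dH H'_nn that in \<open>meson order_trans\<close>)
    have H0: "H 0 = 0" by (simp add: H_def g_def g'_def E_def)
    have Hl: "H l \<le> M"
    proof -
      have "H l = \<mu> + 2 * E + 2 * c / l"
        using l by (simp add: H_def g_def g'_def i_def power2_eq_square)
      also have "\<dots> \<le> E + 2 * E + 2 * (K * E) / l"
        using E cE l by (intro add_mono divide_right_mono) auto
      also have "\<dots> = E * (3 + 2 * K / l)" by (simp add: algebra_simps)
      finally show ?thesis using EM by linarith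
    qed
    have "convex_on {0..l} H"
      by (rule convex_on_realI[of _ _ H']) (use dH H'_mono in auto)
    then have "convex_on {..l} Q"
      unfolding Q_def by (rule convex_on_extend_zero[OF _ l H_mono])
    moreover have "continuous_on {0..l} Q"
      unfolding Q_def H_def g_def g'_def by (intro continuous_intros)
    moreover have "Q z = 0" if "z \<le> 0" for z using that H0 by (simp add: Q_def max_def)
    moreover have "0 \<le> Q z \<and> Q z \<le> M" if "z \<le> l" for z
      using H_mono[of 0 "max z 0"] H_mono[of "max z 0" l] H0 Hl that l by (auto simp: Q_def)
    ultimately have "profile l M Q" by (simp add: profile_def)
    moreover have "((\<lambda>z. exp (P z)) has_real_derivative - g z * exp (P z)) (at z)" for z
      using DERIV_chain2[OF DERIV_exp dP] by (simp add: mult.commute)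
    moreover from this have "((\<lambda>z. - g z * exp (P z)) has_real_derivative ((g z)\<^sup>2 - g' z) * exp (P z)) (at z)" for z
      by (intro DERIV_cong[OF DERIV_mult[OF DERIV_minus[OF dg]]])
         (auto simp: algebra_simps power2_eq_square)
    moreover have "((g z)\<^sup>2 - g' z) * exp (P z) = (Q z - \<mu>) * exp (P z)" if "z \<in> {0..l}" for z
      using that by (simp add: Q_def H_def max_absorb1)
    moreover have "exp (P 0) = 1" "- g 0 * exp (P 0) = - c" "- g l * exp (P l) = 0"
      using l by (simp_all add: P_def g_def i_def)
    ultimately show ?thesis
      by (intro exI[of _ Q] exI[of _ "\<lambda>z. exp (P z)"] exI[of _ "\<lambda>z. - g z * exp (P z)"]
          exI[of _ "\<lambda>z. ((g z)\<^sup>2 - g' z) * exp (P z)"]) (auto simp only: exp_gt_zero)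
  qed
  ultimately show ?thesis by blast
qed

section \<open>A positive solution on the whole tree\<close>

text \<open>
  The distance of the point with coordinate \<open>x\<close> from the endpoint \<open>d\<close> of its edge. Solutions are
  written in terms of it, so that both orientations of an edge are treated at once.
\<close>

definition end_dist :: "('e, 'v) metric_graph \<Rightarrow> 'e \<times> bool \<Rightarrow> real \<Rightarrow> real" where
  "end_dist G d x = (if snd d then len G (fst d) - x else x)"

definition end_sgn :: "'e \<times> bool \<Rightarrow> real" where
  "end_sgn d = (if snd d then - 1 else 1)"

lemma end_dist_mem: "x \<in> {0..len G (fst d)} \<Longrightarrow> end_dist G d x \<in> {0..len G (fst d)}"
  by (auto simp: end_dist_def)

lemma end_dist_end_coord [simp]:
  "end_dist G d (end_coord G d) = 0" "end_dist G d (end_coord G (fst d, \<not> snd d)) = len G (fst d)"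
  by (auto simp: end_dist_def end_coord_def)

lemma end_dist_deriv:
  assumes "\<And>z. (F has_real_derivative F' z) (at z)"
  shows "((\<lambda>x. F (end_dist G d x)) has_real_derivative end_sgn d * F' (end_dist G d x)) (at x within S)"
proof -
  have "(end_dist G d has_real_derivative end_sgn d) (at x within S)"
    unfolding end_dist_def end_sgn_def by (cases "snd d") (auto intro!: derivative_eq_intros)
  from DERIV_chain2[OF assms this] show ?thesis by (simp add: mult.commute)
qed

lemma solves_end_dist:
  assumes F: "\<And>z. (F has_real_derivative F' z) (at z)" "\<And>z. (F' has_real_derivative F'' z) (at z)"
    and ode: "\<And>x. x \<in> {0..len G (fst d)} \<Longrightarrow> F'' (end_dist G d x) = (q (fst d) x - \<mu>) * F (end_dist G d x)"
    and w: "w (fst d) = (\<lambda>x. a * F (end_dist G d x))" "w' (fst d) = (\<lambda>x. a * (end_sgn d * F' (end_dist G d x)))"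
  shows "solves G {fst d} q \<mu> w w'"
proof -
  have sq: "end_sgn d * (end_sgn d * b) = b" for b by (auto simp: end_sgn_def)
  show ?thesis
    unfolding solves_def
  proof (intro ballI conjI)
    fix e x assume "e \<in> {fst d}" and x: "x \<in> {0..len G e}"
    then have e: "e = fst d" by simp
    have x': "x \<in> {0..len G (fst d)}" using x e by simp
    show "(w e has_real_derivative w' e x) (at x within {0..len G e})"
      unfolding e w by (rule DERIV_cmult[OF end_dist_deriv[OF F(1)]])
    have "((\<lambda>x. a * (end_sgn d * F' (end_dist G d x))) has_real_derivative a * F'' (end_dist G d x))
        (at x within {0..len G (fst d)})"
      using DERIV_cmult[OF DERIV_cmult[OF end_dist_deriv[OF F(2), of G d x], of "end_sgn d"], of a]
      by (simp only: sq)
    then show "(w' e has_real_derivative (q e x - \<mu>) * w e x) (at x within {0..len G e})"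
      unfolding e w by (simp only: ode[OF x'] mult.left_commute)
  qed
qed

lemma normal_deriv_end_dist:
  assumes "w' (fst d) = (\<lambda>x. a * (end_sgn d * F' (end_dist G d x)))"
  shows "normal_deriv G w' d = a * F' 0" "normal_deriv G w' (fst d, \<not> snd d) = - a * F' (len G (fst d))"
  by (auto simp: normal_deriv_def assms end_sgn_def end_dist_def end_coord_def)

lemma flux_cong: "(\<And>e. e \<in> S \<Longrightarrow> w e = w' e) \<Longrightarrow> flux G S w v = flux G S w' v"
  unfolding flux_def by (intro sum.cong) (auto simp: normal_deriv_def)

lemma flux_insert:
  assumes "finite S" "fst d \<notin> S"
  shows "flux G (insert (fst d) S) w' v = flux G S w' v
    + (if vert G d = v then normal_deriv G w' d else 0)
    + (if dhead G d = v then normal_deriv G w' (fst d, \<not> snd d) else 0)"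
proof -
  let ?r = "(fst d, \<not> snd d)"
  let ?A = "{d'. fst d' \<in> S \<and> vert G d' = v}" and ?B = "{d' \<in> {d, ?r}. vert G d' = v}"
  have "{d'. fst d' \<in> insert (fst d) S \<and> vert G d' = v} = ?A \<union> ?B"
  proof -
    have "fst d' = fst d \<longleftrightarrow> d' \<in> {d, ?r}" for d' using end_cases[of d' d] by auto
    then show ?thesis by auto
  qed
  moreover have "finite ?A"
    by (rule finite_subset[of _ "S \<times> UNIV"]) (use assms in auto)
  moreover have "?A \<inter> ?B = {}" using assms by auto
  ultimately have "flux G (insert (fst d) S) w' v = flux G S w' v + (\<Sum>d'\<in>?B. normal_deriv G w' d')"
    unfolding flux_def by (simp add: sum.union_disjoint)
  also have "(\<Sum>d'\<in>?B. normal_deriv G w' d')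
      = (\<Sum>d'\<in>{d, ?r}. if vert G d' = v then normal_deriv G w' d' else 0)"
    by (rule sum.inter_filter) simp
  also have "\<dots> = (if vert G d = v then normal_deriv G w' d else 0)
    + (if dhead G d = v then normal_deriv G w' ?r else 0)"
  proof -
    have "d \<noteq> ?r" by (cases d) auto
    then show ?thesis by (simp add: dhead_def)
  qed
  finally show ?thesis by simp
qed

lemma flux_outside:
  assumes "v \<notin> endpoints G S" shows "flux G S w' v = 0"
proof -
  have "{d. fst d \<in> S \<and> vert G d = v} = {}" using assms vert_in_endpoints by fastforce
  then show ?thesis by (simp only: flux_def sum.empty)
qed

lemma at_end_end_dist:
  assumes "w (fst d) = (\<lambda>x. a * F (end_dist G d x))"
  shows "at_end G w d = a * F 0" "at_end G w (fst d, \<not> snd d) = a * F (len G (fst d))"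
  by (simp_all add: at_end_def assms)

text \<open>
  Here \<open>d\<close> is directed towards the leaf, so the potential vanishes at the inner endpoint.
\<close>

definition leaf_potential :: "('e, 'v) metric_graph \<Rightarrow> 'e \<times> bool \<Rightarrow> (real \<Rightarrow> real) \<Rightarrow> 'e \<Rightarrow> real \<Rightarrow> real" where
  "leaf_potential G d Q e x = (if e = fst d then Q (end_dist G d x) else 0)"

text \<open>
  Peeling off leaf edges reduces the whole tree to its root edge \<open>f\<close>. The induction needs Robin
  coefficients \<open>c v\<close> at all vertices, which take the place of branches that have been removed. An
  attached edge is solved first, then its effect is added to the coefficient of the vertex where it
  is attached, and its solution is scaled to match the value \<open>y\<close> there. Only the coefficient at the
  leaf of \<open>f\<close> stays \<open>0\<close>, since nothing is attached there. The potential on \<open>f\<close> is chosen at the very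
  end, when the coefficient at its inner endpoint is known. The order of magnitude \<open>K \<mu>\<close> of the
  coefficients is kept because the potential on \<open>f\<close> is convex only under this restriction.
\<close>

lemma positive_solution:
  fixes G :: "('e, 'v) metric_graph"
  assumes "tree_order G f es" and f: "f = fst d"
    and leaf: "\<And>d'. fst d' \<in> edges G \<Longrightarrow> vert G d' = dhead G d \<Longrightarrow> d' = (fst d, \<not> snd d)"
    and len: "\<And>e. e \<in> edges G \<Longrightarrow> 0 < len G e" and M: "0 < M"
  shows "0 \<le> K \<Longrightarrow> \<exists>\<delta>>0. \<forall>\<mu> c. 0 < \<mu> \<and> \<mu> \<le> \<delta> \<and> c (dhead G d) = 0 \<and> (\<forall>v. 0 \<le> c v \<and> c v \<le> K * \<mu>) \<longrightarrow>
    (\<exists>Q \<phi> \<phi>' y. profile (len G f) M Q \<and> solves G (set es) (leaf_potential G d Q) \<mu> \<phi> \<phi>'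
      \<and> (\<forall>e\<in>set es. \<forall>x\<in>{0..len G e}. 0 < \<phi> e x)
      \<and> (\<forall>d'. fst d' \<in> set es \<longrightarrow> at_end G \<phi> d' = y (vert G d'))
      \<and> (\<forall>v\<in>endpoints G (set es). flux G (set es) \<phi>' v + c v * y v = 0))"
  using assms(1)
proof (induction arbitrary: K rule: tree_order.induct)
  case root
  have lf: "0 < len G f" using len root by blast
  let ?l = "len G f" and ?p = "vert G d" and ?n = "dhead G d"
  have pn: "?p \<noteq> ?n"
  proof
    assume "?p = ?n"
    then have "d = (fst d, \<not> snd d)" using leaf root f by blast
    then show False by (cases d) auto
  qed
  obtain \<delta> where \<delta>: "\<delta> > 0" "\<And>\<mu> c. 0 < \<mu> \<and> \<mu> \<le> \<delta> \<and> 0 \<le> c \<and> c \<le> K * \<mu> \<Longrightarrow>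
    (\<exists>Q F F' F''. profile ?l M Q
      \<and> (\<forall>z. (F has_real_derivative F' z) (at z) \<and> (F' has_real_derivative F'' z) (at z))
      \<and> (\<forall>z\<in>{0..?l}. F'' z = (Q z - \<mu>) * F z) \<and> (\<forall>z. 0 < F z)
      \<and> F 0 = 1 \<and> F' 0 = - c \<and> F' ?l = 0)"
    using leaf_edge_solution[OF lf root(2) M] by blast
  show ?case
  proof (intro exI[of _ \<delta>] conjI allI impI, rule \<delta>(1), elim conjE)
    fix \<mu> c assume \<mu>: "0 < \<mu>" "\<mu> \<le> \<delta>" and c: "c ?n = 0" "\<forall>v. 0 \<le> c v \<and> c v \<le> K * \<mu>"
    obtain Q F F' F'' where Q: "profile ?l M Q"
      and F: "\<And>z. (F has_real_derivative F' z) (at z)" "\<And>z. (F' has_real_derivative F'' z) (at z)"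
        "\<And>z. z \<in> {0..?l} \<Longrightarrow> F'' z = (Q z - \<mu>) * F z" "\<And>z. 0 < F z"
        "F 0 = 1" "F' 0 = - c ?p" "F' ?l = 0"
    proof -
      have "0 < \<mu> \<and> \<mu> \<le> \<delta> \<and> 0 \<le> c ?p \<and> c ?p \<le> K * \<mu>" using \<mu> c(2) by blast
      from \<delta>(2)[OF this] show thesis
        by (elim exE conjE) (rule that, assumption, blast, blast, blast, blast, assumption+)
    qed
    define \<phi> :: "'e \<Rightarrow> real \<Rightarrow> real" where "\<phi> = (\<lambda>e x. 1 * F (end_dist G d x))"
    define \<phi>' :: "'e \<Rightarrow> real \<Rightarrow> real" where "\<phi>' = (\<lambda>e x. 1 * (end_sgn d * F' (end_dist G d x)))"
    define y where "y v = (if v = ?p then 1 else F ?l)" for v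
    have "solves G {fst d} (leaf_potential G d Q) \<mu> \<phi> \<phi>'"
      by (rule solves_end_dist[OF F(1,2), where a = 1])
         (use F(3) end_dist_mem[of _ G d] f in \<open>auto simp: leaf_potential_def \<phi>_def \<phi>'_def\<close>)
    moreover have "at_end G \<phi> d' = y (vert G d')" if "fst d' = f" for d'
    proof -
      have "at_end G \<phi> d = y ?p" "at_end G \<phi> (fst d, \<not> snd d) = y ?n"
        using at_end_end_dist[of \<phi> d 1 F G] pn F(5) f by (auto simp: \<phi>_def y_def)
      then show ?thesis using end_cases[of d' d] that f by (auto simp: dhead_def)
    qed
    moreover have "flux G {f} \<phi>' v + c v * y v = 0" if "v \<in> endpoints G {f}" for v
    proof -
      have v: "v = ?p \<or> v = ?n"
        using that endpoints_insert[of G d "{}"] f by (auto simp: endpoints_def)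
      have "flux G {f} \<phi>' v = (if ?p = v then F' 0 else 0) + (if ?n = v then - F' ?l else 0)"
        using flux_insert[of "{}" d G \<phi>' v] normal_deriv_end_dist[of \<phi>' d 1 F' G] f
        by (simp add: \<phi>'_def flux_def)
      then show ?thesis using v pn F c(1) by (auto simp: y_def)
    qed
    ultimately show "\<exists>Q \<phi> \<phi>' y. profile ?l M Q \<and> solves G (set [f]) (leaf_potential G d Q) \<mu> \<phi> \<phi>'
      \<and> (\<forall>e\<in>set [f]. \<forall>x\<in>{0..len G e}. 0 < \<phi> e x)
      \<and> (\<forall>d'. fst d' \<in> set [f] \<longrightarrow> at_end G \<phi> d' = y (vert G d'))
      \<and> (\<forall>v\<in>endpoints G (set [f]). flux G (set [f]) \<phi>' v + c v * y v = 0)"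
      using Q F(4) f by (intro exI[of _ Q] exI[of _ \<phi>] exI[of _ \<phi>'] exI[of _ y]) (auto simp: \<phi>_def)
  qed
next
  case (attach es d1)
  let ?h = "fst d1" and ?p = "vert G d1" and ?n = "dhead G d1"
  let ?l = "len G ?h"
  have hl: "0 < ?l" using len attach.hyps(2) by blast
  have ese: "set es \<subseteq> edges G" "f \<in> set es" using tree_order_edges[OF attach.hyps(1)] by auto
  have hes: "?h \<notin> set es" using attach.hyps(4) dhead_in_endpoints by blast
  have pn: "?p \<noteq> ?n" using attach.hyps(3,4) by auto
  have pleaf: "?p \<noteq> dhead G d"
    using leaf[of d1] attach.hyps(2) hes ese f by (metis fst_conv)
  have nleaf: "?n \<noteq> dhead G d"
    using attach.hyps(4) dhead_in_endpoints[of d "set es" G] ese f by metis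
  define K1 where "K1 = K + 2 * (?l + K)"
  have K1: "0 \<le> K1" using attach.prems hl by (simp add: K1_def)
  obtain \<delta>1 where \<delta>1: "\<delta>1 > 0" "\<And>\<mu> c. 0 < \<mu> \<and> \<mu> \<le> \<delta>1 \<and> c (dhead G d) = 0 \<and> (\<forall>v. 0 \<le> c v \<and> c v \<le> K1 * \<mu>) \<Longrightarrow>
    (\<exists>Q \<phi> \<phi>' y. profile (len G f) M Q \<and> solves G (set es) (leaf_potential G d Q) \<mu> \<phi> \<phi>'
      \<and> (\<forall>e\<in>set es. \<forall>x\<in>{0..len G e}. 0 < \<phi> e x)
      \<and> (\<forall>d'. fst d' \<in> set es \<longrightarrow> at_end G \<phi> d' = y (vert G d'))
      \<and> (\<forall>v\<in>endpoints G (set es). flux G (set es) \<phi>' v + c v * y v = 0))"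
    using attach.IH[OF K1] by blast
  obtain \<delta>2 where \<delta>2: "\<delta>2 > 0" "\<And>\<mu> c. 0 < \<mu> \<and> \<mu> \<le> \<delta>2 \<and> 0 \<le> c \<and> c \<le> K * \<mu> \<Longrightarrow>
    (\<exists>F F'. (\<forall>z. (F has_real_derivative F' z) (at z) \<and> (F' has_real_derivative - \<mu> * F z) (at z))
      \<and> (\<forall>z\<in>{0..?l}. 0 < F z) \<and> F 0 = 1 \<and> F' ?l = c * F ?l \<and> 0 \<le> F' 0 \<and> F' 0 \<le> 2 * (?l + K) * \<mu>)"
    using attached_edge_solution[OF hl attach.prems] by blast
  show ?case
  proof (intro exI[of _ "min \<delta>1 \<delta>2"] conjI allI impI, simp add: \<delta>1(1) \<delta>2(1), elim conjE)
    fix \<mu> c assume \<mu>: "0 < \<mu>" "\<mu> \<le> min \<delta>1 \<delta>2"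
      and c: "c (dhead G d) = 0" "\<forall>v. 0 \<le> c v \<and> c v \<le> K * \<mu>"
    obtain F F' where F: "\<And>z. (F has_real_derivative F' z) (at z)"
        "\<And>z. (F' has_real_derivative - \<mu> * F z) (at z)" "\<And>z. z \<in> {0..?l} \<Longrightarrow> 0 < F z"
        "F 0 = 1" "F' ?l = c ?n * F ?l" "0 \<le> F' 0" "F' 0 \<le> 2 * (?l + K) * \<mu>"
    proof -
      have "0 < \<mu> \<and> \<mu> \<le> \<delta>2 \<and> 0 \<le> c ?n \<and> c ?n \<le> K * \<mu>" using \<mu> c(2) by auto
      from \<delta>2(2)[OF this] show thesis
        by (elim exE conjE) (rule that, blast, blast, blast, assumption+)
    qed
    \<comment> \<open>Seen from the rest of the tree, the attached edge only changes the coefficient at \<open>?p\<close>.\<close>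
    define c1 where "c1 = c(?p := c ?p + F' 0)"
    have "0 \<le> c1 v \<and> c1 v \<le> K1 * \<mu>" for v
    proof -
      have "0 \<le> 2 * (?l + K) * \<mu>" using hl attach.prems \<mu> by simp
      then have "K * \<mu> \<le> K1 * \<mu>" unfolding K1_def distrib_right by linarith
      moreover have "c ?p + F' 0 \<le> K1 * \<mu>"
        using c(2) F(7) unfolding K1_def distrib_right[of K "2 * (?l + K)"] by (intro add_mono) auto
      ultimately show ?thesis using c(2) F(6) by (auto simp: c1_def intro: order_trans)
    qed
    then have "0 < \<mu> \<and> \<mu> \<le> \<delta>1 \<and> c1 (dhead G d) = 0 \<and> (\<forall>v. 0 \<le> c1 v \<and> c1 v \<le> K1 * \<mu>)"
      using \<mu> c(1) pleaf by (auto simp: c1_def)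
    note IH = \<delta>1(2)[OF this]
    obtain Q \<phi> \<phi>' y where Q: "profile (len G f) M Q"
      and s: "solves G (set es) (leaf_potential G d Q) \<mu> \<phi> \<phi>'"
      and pos: "\<forall>e\<in>set es. \<forall>x\<in>{0..len G e}. 0 < \<phi> e x"
      and y: "\<forall>d'. fst d' \<in> set es \<longrightarrow> at_end G \<phi> d' = y (vert G d')"
      and fl: "\<forall>v\<in>endpoints G (set es). flux G (set es) \<phi>' v + c1 v * y v = 0"
      using IH by (elim exE conjE) (rule that)
    have yp: "0 < y ?p"
    proof -
      obtain d' where d': "fst d' \<in> set es" "vert G d' = ?p"
        using attach.hyps(3) by (auto simp: endpoints_def)
      have "end_coord G d' \<in> {0..len G (fst d')}"
        using len[of "fst d'"] d' ese by (auto simp: end_coord_def)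
      then have "0 < at_end G \<phi> d'" using pos d'(1) by (auto simp: at_end_def)
      then show ?thesis using y d' by metis
    qed
    define \<psi> where "\<psi> = \<phi>(?h := (\<lambda>x. y ?p * F (end_dist G d1 x)))"
    define \<psi>' where "\<psi>' = \<phi>'(?h := (\<lambda>x. y ?p * (end_sgn d1 * F' (end_dist G d1 x))))"
    define z where "z = y(?n := y ?p * F ?l)"
    have "solves G (set es) (leaf_potential G d Q) \<mu> \<psi> \<psi>'"
    proof -
      have "\<psi> e = \<phi> e" "\<psi>' e = \<phi>' e" if "e \<in> set es" for e
        using that hes by (auto simp: \<psi>_def \<psi>'_def)
      then show ?thesis using s by (simp add: solves_def)
    qed
    moreover have "solves G {?h} (leaf_potential G d Q) \<mu> \<psi> \<psi>'"
      by (rule solves_end_dist[OF F(1,2), where a = "y ?p"])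
         (use hes ese f in \<open>auto simp: leaf_potential_def \<psi>_def \<psi>'_def\<close>)
    ultimately have "solves G (set (?h # es)) (leaf_potential G d Q) \<mu> \<psi> \<psi>'"
      by (auto simp: solves_def)
    moreover have "0 < \<psi> e x" if "e \<in> set (?h # es)" "x \<in> {0..len G e}" for e x
    proof (cases "e = ?h")
      case True
      then show ?thesis using F(3)[OF end_dist_mem[of x G d1]] that(2) yp by (simp add: \<psi>_def)
    next
      case False
      then show ?thesis using pos that by (simp add: \<psi>_def)
    qed
    moreover have "at_end G \<psi> d' = z (vert G d')" if "fst d' \<in> set (?h # es)" for d'
    proof (cases "fst d' = ?h")
      case True
      have "at_end G \<psi> d1 = z ?p" "at_end G \<psi> (fst d1, \<not> snd d1) = z ?n"
        using at_end_end_dist[of \<psi> d1 "y ?p" F G] pn F(4) by (auto simp: \<psi>_def z_def)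
      then show ?thesis using end_cases[OF True] by (auto simp: dhead_def)
    next
      case False
      then have "vert G d' \<noteq> ?n" using that attach.hyps(4) vert_in_endpoints[of d' "set es" G] by auto
      moreover have "at_end G \<phi> d' = y (vert G d')" using y that False by (metis insert_iff list.set(2))
      ultimately show ?thesis using False by (simp add: z_def \<psi>_def at_end_def)
    qed
    moreover have "flux G (set (?h # es)) \<psi>' v + c v * z v = 0" if v: "v \<in> endpoints G (set (?h # es))" for v
    proof -
      have "flux G (set es) \<psi>' v = flux G (set es) \<phi>' v"
        by (rule flux_cong) (use hes in \<open>auto simp: \<psi>'_def\<close>)
      moreover have "\<psi>' ?h = (\<lambda>x. y ?p * (end_sgn d1 * F' (end_dist G d1 x)))"
        by (simp add: \<psi>'_def)
      note nd = normal_deriv_end_dist[of \<psi>' d1 "y ?p" F', OF this]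
      ultimately have flx: "flux G (set (?h # es)) \<psi>' v = flux G (set es) \<phi>' v
          + (if ?p = v then y ?p * F' 0 else 0) + (if ?n = v then - y ?p * F' ?l else 0)"
        using flux_insert[of "set es" d1 G \<psi>' v] hes nd by simp
      show ?thesis
      proof (cases "v = ?n")
        case True
        then show ?thesis using flx pn flux_outside[OF attach.hyps(4)] F(5) by (simp add: z_def)
      next
        case False
        then have "v \<in> endpoints G (set es)"
          using v attach.hyps(3) by (auto simp: endpoints_insert)
        with fl have "flux G (set es) \<phi>' v + c1 v * y v = 0" by blast
        then show ?thesis using flx False by (auto simp: z_def c1_def algebra_simps)
      qed
    qed
    ultimately show "\<exists>Q \<phi> \<phi>' y. profile (len G f) M Q \<and> solves G (set (?h # es)) (leaf_potential G d Q) \<mu> \<phi> \<phi>'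
      \<and> (\<forall>e\<in>set (?h # es). \<forall>x\<in>{0..len G e}. 0 < \<phi> e x)
      \<and> (\<forall>d'. fst d' \<in> set (?h # es) \<longrightarrow> at_end G \<phi> d' = y (vert G d'))
      \<and> (\<forall>v\<in>endpoints G (set (?h # es)). flux G (set (?h # es)) \<phi>' v + c v * y v = 0)"
      using Q by blast
  qed
qed

section \<open>Multiplicities are finite\<close>

context vector_space
begin

text \<open>
  The dimension of an infinite-dimensional space is \<open>0\<close> by convention. To conclude that an eigenvalue
  has positive multiplicity one therefore has to know that its eigenspace is finite-dimensional, and
  this holds because finitely many linear functionals separate its points.
\<close>

lemma finite_span_of_functionals:
  fixes \<Lambda> :: "'i \<Rightarrow> 'b \<Rightarrow> 'a"
  assumes "finite I" "subspace W"
    and "\<And>i x y. i \<in> I \<Longrightarrow> x \<in> W \<Longrightarrow> y \<in> W \<Longrightarrow> \<Lambda> i (x + y) = \<Lambda> i x + \<Lambda> i y"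
    and "\<And>i c x. i \<in> I \<Longrightarrow> x \<in> W \<Longrightarrow> \<Lambda> i (scale c x) = c * \<Lambda> i x"
    and "\<And>x. x \<in> W \<Longrightarrow> (\<And>i. i \<in> I \<Longrightarrow> \<Lambda> i x = 0) \<Longrightarrow> x = 0"
  shows "\<exists>B. finite B \<and> W \<subseteq> span B"
  using assms
proof (induction I arbitrary: W rule: finite_induct)
  case empty
  then show ?case by (intro exI[of _ "{}"]) (auto simp: span_empty)
next
  case (insert j I)
  note W = insert.prems(1) and add = insert.prems(2) and scl = insert.prems(3) and ker = insert.prems(4)
  let ?W = "{x \<in> W. \<Lambda> j x = 0}"
  have "subspace ?W"
  proof (rule subspaceI)
    have "\<Lambda> j (scale 0 0) = 0 * \<Lambda> j 0" using scl subspace_0[OF W] by blast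
    then show "0 \<in> ?W" using subspace_0[OF W] by simp
  qed (use subspace_add[OF W] subspace_scale[OF W] add scl in auto)
  moreover have "x = 0" if "x \<in> ?W" "\<And>i. i \<in> I \<Longrightarrow> \<Lambda> i x = 0" for x
    using ker[of x] that by blast
  ultimately have "\<exists>B. finite B \<and> ?W \<subseteq> span B"
    by (intro insert.IH) (use add scl in auto)
  then obtain B where B: "finite B" "?W \<subseteq> span B" by blast
  show ?case
  proof (cases "\<exists>b\<in>W. \<Lambda> j b \<noteq> 0")
    case False
    then have "W \<subseteq> ?W" by auto
    then show ?thesis using B by blast
  next
    case True
    then obtain b where b: "b \<in> W" "\<Lambda> j b \<noteq> 0" by auto
    have "x \<in> span (Set.insert b B)" if x: "x \<in> W" for x
    proof -
      let ?c = "\<Lambda> j x / \<Lambda> j b"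
      have "x + scale (- ?c) b \<in> ?W"
        using subspace_add[OF W x subspace_scale[OF W b(1), of "- ?c"]]
          add[of j x "scale (- ?c) b"] scl[of j b "- ?c"] subspace_scale[OF W b(1), of "- ?c"] x b
        by simp
      then have "x + scale (- ?c) b \<in> span (Set.insert b B)"
        using B(2) span_mono[of B "Set.insert b B"] by blast
      moreover have "scale ?c b \<in> span (Set.insert b B)"
        by (intro span_scale span_base) auto
      ultimately have "(x + scale (- ?c) b) + scale ?c b \<in> span (Set.insert b B)"
        by (rule span_add)
      then show ?thesis by (simp add: scale_minus_left)
    qed
    then show ?thesis using B(1) by (intro exI[of _ "Set.insert b B"]) auto
  qed
qed

lemma dim_pos_of_finite_span:
  assumes "finite B" "W \<subseteq> span B" "x \<in> W" "x \<noteq> 0"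
  shows "1 \<le> dim W"
proof -
  obtain C where C: "C \<subseteq> W" "independent C" "W \<subseteq> span C" "card C = dim W"
    using basis_exists by blast
  have "finite C" using independent_span_bound[OF assms(1) C(2)] C(1) assms(2) by blast
  moreover have "C \<noteq> {}" using C(3) assms(3,4) by (auto simp: span_empty)
  ultimately show ?thesis using C(4) card_0_eq by fastforce
qed

end

text \<open>
  The energy \<open>w\<^sup>2 + w'\<^sup>2\<close> grows at most exponentially with the rate \<open>1 + C\<close>, where \<open>C\<close> bounds the
  coefficient, so it stays \<open>0\<close> if it is \<open>0\<close> initially.
\<close>

lemma zero_initial_data:
  fixes w :: "real \<Rightarrow> real"
  assumes l: "0 < l" and r: "continuous_on {0..l} r"
    and w: "\<And>x. x \<in> {0..l} \<Longrightarrow> (w has_real_derivative w' x) (at x within {0..l})"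
      "\<And>x. x \<in> {0..l} \<Longrightarrow> (w' has_real_derivative r x * w x) (at x within {0..l})"
    and init: "w 0 = 0" "w' 0 = 0" and x: "x \<in> {0..l}"
  shows "w x = 0"
proof -
  obtain C where C: "\<forall>x\<in>{0..l}. \<bar>r x\<bar> \<le> C"
  proof -
    have "bounded (r ` {0..l})"
      by (intro compact_imp_bounded compact_continuous_image[OF r]) simp
    then show thesis using that by (auto simp: bounded_iff simp del: atLeastAtMost_iff)
  qed
  let ?E = "\<lambda>x. (w x)\<^sup>2 + (w' x)\<^sup>2"
  \<comment> \<open>The weighted energy decreases; the sign turns this into a nonnegative derivative.\<close>
  let ?g = "\<lambda>x. - (exp (- (1 + C) * x) * ?E x)"
  let ?g' = "\<lambda>x. exp (- (1 + C) * x) * ((1 + C) * ?E x - 2 * w x * w' x * (1 + r x))"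
  have der: "(?g has_real_derivative ?g' y) (at y within {0..l})" if y: "y \<in> {0..l}" for y
  proof -
    have e: "((\<lambda>x. exp (- (1 + C) * x)) has_real_derivative - (1 + C) * exp (- (1 + C) * y)) (at y within {0..l})"
      by (auto intro!: derivative_eq_intros)
    note D = DERIV_minus[OF DERIV_mult[OF e DERIV_add[OF DERIV_power[OF w(1)[OF y], of 2] DERIV_power[OF w(2)[OF y], of 2]]]]
    show ?thesis by (rule DERIV_cong[OF D]) (simp add: algebra_simps)
  qed
  have nn: "0 \<le> ?g' y" if y: "y \<in> {0..l}" for y
  proof -
    have "2 * w y * w' y * (1 + r y) \<le> \<bar>2 * w y * w' y\<bar> * \<bar>1 + r y\<bar>"
      by (metis abs_ge_self abs_mult)
    also have "\<dots> \<le> ?E y * (1 + C)"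
    proof (intro mult_mono)
      show "\<bar>2 * w y * w' y\<bar> \<le> ?E y"
        using sum_squares_bound[of "w y" "w' y"] sum_squares_bound[of "- w y" "w' y"] by (simp add: abs_le_iff)
      show "\<bar>1 + r y\<bar> \<le> 1 + C" using bspec[OF C y] by (simp add: abs_le_iff)
    qed auto
    finally show ?thesis by (simp add: mult.commute)
  qed
  have "?g 0 \<le> ?g x"
    using nonneg_deriv_within_le[OF der nn, of 0 x] x by auto
  then have "exp (- (1 + C) * x) * ?E x \<le> 0" using init by simp
  then have "?E x \<le> 0" by (simp add: mult_le_0_iff)
  then show ?thesis by (simp add: sum_power2_le_zero_iff)
qed

lemma classical_add:
  assumes "classical G q \<mu> u u'" "classical G q \<mu> w w'"
  shows "classical G q \<mu> (u + w) (u' + w')"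
proof -
  have "well_defined_on G (u + w)"
    using assms unfolding classical_def well_defined_on_def plus_fun_def by metis
  moreover have "solves G (edges G) q \<mu> (u + w) (u' + w')"
    unfolding solves_def
  proof (intro ballI conjI)
    fix e x assume "e \<in> edges G" "x \<in> {0..len G e}"
    note d = classical_derivs[OF assms(1) this] classical_derivs[OF assms(2) this]
    show "((u + w) e has_real_derivative (u' + w') e x) (at x within {0..len G e})"
      using DERIV_add[OF d(1) d(3)] by (simp add: plus_fun_def)
    show "((u' + w') e has_real_derivative (q e x - \<mu>) * (u + w) e x) (at x within {0..len G e})"
      using DERIV_add[OF d(2) d(4)] by (simp add: plus_fun_def algebra_simps)
  qed
  moreover have "kirchhoff G (u' + w')"
  proof -
    have "normal_deriv G (u' + w') d = normal_deriv G u' d + normal_deriv G w' d" for d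
      by (simp add: normal_deriv_def)
    then show ?thesis using assms by (simp add: classical_def kirchhoff_def sum.distrib)
  qed
  ultimately show ?thesis by (simp add: classical_def)
qed

lemma classical_scale:
  assumes "classical G q \<mu> u u'"
  shows "classical G q \<mu> (fun_scale c u) (fun_scale c u')"
proof -
  have "well_defined_on G (fun_scale c u)"
    using assms unfolding classical_def well_defined_on_def fun_scale_def by metis
  moreover have "solves G (edges G) q \<mu> (fun_scale c u) (fun_scale c u')"
    unfolding solves_def
  proof (intro ballI conjI)
    fix e x assume "e \<in> edges G" "x \<in> {0..len G e}"
    note d = classical_derivs[OF assms this]
    show "(fun_scale c u e has_real_derivative fun_scale c u' e x) (at x within {0..len G e})"
      using DERIV_cmult[OF d(1)] by (simp add: fun_scale_def)
    show "(fun_scale c u' e has_real_derivative (q e x - \<mu>) * fun_scale c u e x) (at x within {0..len G e})"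
      using DERIV_cmult[OF d(2), of c] by (simp add: fun_scale_def mult.left_commute)
  qed
  moreover have "kirchhoff G (fun_scale c u')"
  proof -
    have "normal_deriv G (fun_scale c u') d = c * normal_deriv G u' d" for d
      by (simp add: normal_deriv_def fun_scale_def)
    then show ?thesis using assms by (simp add: classical_def kirchhoff_def flip: sum_distrib_left)
  qed
  ultimately show ?thesis by (simp add: classical_def)
qed

lemma classical_zero: "classical G q \<mu> (\<lambda>_ _. 0) (\<lambda>_ _. 0)"
  by (auto simp: classical_def well_defined_on_def solves_def kirchhoff_def normal_deriv_zero)

lemma multiplicity_pos:
  assumes fin: "finite (edges G)" and len: "\<And>e. e \<in> edges G \<Longrightarrow> 0 < len G e"
    and q: "\<And>e. e \<in> edges G \<Longrightarrow> continuous_on {0..len G e} (q e)"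
    and u: "eigenfunction G q \<mu> u"
  shows "1 \<le> multiplicity_eig G q \<mu>"
proof -
  let ?W = "eigenspace G q \<mu>"
  have W: "u \<in> ?W \<longleftrightarrow> (\<exists>u'. classical G q \<mu> u u') \<and> (\<forall>e x. \<not> (e \<in> edges G \<and> x \<in> {0..len G e}) \<longrightarrow> u e x = 0)" for u
    using schroedinger_iff_classical[OF len q] by (simp add: eigenspace_def)
  have sub: "funs.subspace ?W"
  proof (rule funs.subspaceI)
    show "0 \<in> ?W" using classical_zero[of G q \<mu>] by (auto simp: W zero_fun_def)
    show "u + w \<in> ?W" if "u \<in> ?W" "w \<in> ?W" for u w
      using that classical_add[of G q \<mu>] by (fastforce simp: W)
    show "fun_scale c u \<in> ?W" if "u \<in> ?W" for c u
      using that classical_scale[of G q \<mu>] by (fastforce simp: W fun_scale_def)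
  qed
  \<comment> \<open>The initial values and slopes on all edges separate the points of the eigenspace.\<close>
  define \<Lambda> where "\<Lambda> i u = (case i of (e, b) \<Rightarrow>
    if b then (THE m. (u e has_real_derivative m) (at 0 within {0..len G e})) else u e 0)"
    for i :: "'a \<times> bool" and u :: "'a \<Rightarrow> real \<Rightarrow> real"
  have slope: "\<Lambda> (e, True) u = u' e 0" if u: "classical G q \<mu> u u'" and e: "e \<in> edges G" for u u' e
  proof -
    have 0: "0 \<in> {0..len G e}" using len[OF e] by simp
    show ?thesis unfolding \<Lambda>_def
      using classical_derivs(1)[OF u e 0] deriv_within_unique[OF len[OF e] 0] by (auto intro!: the_equality)
  qed
  have val0: "\<Lambda> (e, False) u = u e 0" for e u by (simp add: \<Lambda>_def)
  have "\<exists>B. finite B \<and> ?W \<subseteq> funs.span B"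
  proof (rule funs.finite_span_of_functionals[OF _ sub, of "edges G \<times> UNIV" \<Lambda>])
    show "finite (edges G \<times> (UNIV :: bool set))" using fin by simp
    show "\<Lambda> i (u + w) = \<Lambda> i u + \<Lambda> i w" if i: "i \<in> edges G \<times> UNIV" and uw: "u \<in> ?W" "w \<in> ?W" for i u w
    proof -
      obtain u' w' where "classical G q \<mu> u u'" "classical G q \<mu> w w'" using uw W by blast
      then show ?thesis
        using i slope[OF classical_add] slope val0 by (cases i; cases "snd i") auto
    qed
    show "\<Lambda> i (fun_scale c u) = c * \<Lambda> i u" if i: "i \<in> edges G \<times> UNIV" and u: "u \<in> ?W" for i c u
    proof -
      obtain u' where "classical G q \<mu> u u'" using u W by blast
      then show ?thesis
        using i slope[OF classical_scale] slope val0 by (cases i; cases "snd i") (auto simp: fun_scale_def)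
    qed
    show "u = 0" if u: "u \<in> ?W" and 0: "\<And>i. i \<in> edges G \<times> UNIV \<Longrightarrow> \<Lambda> i u = 0" for u
    proof (intro ext)
      fix e x
      obtain u' where u': "classical G q \<mu> u u'" using u W by blast
      have "u e x = 0"
      proof (cases "e \<in> edges G \<and> x \<in> {0..len G e}")
        case True
        then have e: "e \<in> edges G" by blast
        show ?thesis
        proof (rule zero_initial_data[OF len[OF e] _ classical_derivs[OF u' e]])
          show "continuous_on {0..len G e} (\<lambda>x. q e x - \<mu>)" by (intro continuous_intros q e)
          show "u e 0 = 0" "u' e 0 = 0" using 0[of "(e, False)"] 0[of "(e, True)"] e slope[OF u' e] val0 by auto
        qed (use True in auto)
      next
        case False
        then show ?thesis using u W by blast
      qed
      then show "u e x = 0 e x" by simp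
    qed
  qed
  then obtain B where "finite B" "?W \<subseteq> funs.span B" by blast
  moreover have "u \<in> ?W" "u \<noteq> 0" using u by (auto simp: eigenfunction_def zero_fun_def)
  ultimately have "1 \<le> funs.dim ?W" by (rule funs.dim_pos_of_finite_span)
  then show ?thesis by (simp add: multiplicity_eig_def)
qed

section \<open>Potentials supported on a leaf edge\<close>

lemma along_zero_outside:
  "(\<And>d. d \<in> set ds \<Longrightarrow> q (fst d) = (\<lambda>_. 0)) \<Longrightarrow> along G q ds t = 0"
  by (induction ds arbitrary: t) auto

lemma along_snoc:
  assumes Q: "\<And>z. z \<le> 0 \<Longrightarrow> Q z = 0" and qd: "q (fst d) = (\<lambda>x. Q (end_dist G d x))"
    and zero: "\<And>d'. d' \<in> set ds \<Longrightarrow> q (fst d') = (\<lambda>_. 0)"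
    and len: "\<And>d'. d' \<in> set ds \<Longrightarrow> 0 < len G (fst d')"
  shows "t \<le> path_length G (ds @ [d]) \<Longrightarrow> along G q (ds @ [d]) t = Q (t - path_length G ds)"
  using zero len
proof (induction ds arbitrary: t)
  case Nil
  then show ?case by (simp add: path_length_def qd end_dist_def)
next
  case (Cons a ds)
  have "0 \<le> path_length G ds"
  proof -
    have "0 \<le> len G (fst d')" if "d' \<in> set ds" for d' using Cons.prems(3)[of d'] that by simp
    then show ?thesis unfolding path_length_def by (intro sum_list_nonneg) auto
  qed
  then show ?case using Cons by (simp add: path_length_def Q diff_diff_eq add.commute)
qed

lemma convex_on_affine:
  fixes Q :: "real \<Rightarrow> real"
  assumes Q: "convex_on S Q" and g: "\<And>t. g t = a + b * t" "g ` T \<subseteq> S" and T: "convex T"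
    and f: "\<And>t. t \<in> T \<Longrightarrow> f t = Q (g t)"
  shows "convex_on T f"
proof (rule convex_onI[OF _ T])
  fix t x y :: real assume t: "0 < t" "t < 1" and xy: "x \<in> T" "y \<in> T"
  have "(1 - t) * x + t * y \<in> T" using convexD_alt[OF T xy, of t] t by simp
  then have "f ((1 - t) * x + t * y) = Q ((1 - t) * g x + t * g y)"
    using f by (simp add: g(1) algebra_simps)
  also have "\<dots> \<le> (1 - t) * Q (g x) + t * Q (g y)"
    using convex_onD[OF Q, of t "g x" "g y"] xy t g(2) by auto
  finally show "f ((1 - t) *\<^sub>R x + t *\<^sub>R y) \<le> (1 - t) * f x + t * f y" using f xy by simp
qed

text \<open>
  A path between two leaves that contains the leaf edge begins or ends with it, because no other edge
  touches the leaf. Along such a path the potential is the profile, read forwards or backwards, and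
  the zero continuation of the profile covers the rest of the path.
\<close>

lemma leaf_potential_admissible:
  assumes G: "metric_tree G" and d: "fst d \<in> edges G"
    and leaf: "\<And>d'. fst d' \<in> edges G \<Longrightarrow> vert G d' = dhead G d \<Longrightarrow> d' = (fst d, \<not> snd d)"
    and Q: "profile (len G (fst d)) M Q" and M: "0 < M"
  shows "leaf_potential G d Q \<in> convex_potentials G M"
proof -
  let ?q = "leaf_potential G d Q" and ?l = "len G (fst d)" and ?r = "(fst d, \<not> snd d)"
  have len: "0 < len G e" if "e \<in> edges G" for e
    using G that by (auto simp: metric_tree_def compact_metric_graph_def)
  have Q0: "Q z = 0" if "z \<le> 0" for z using Q that by (simp add: profile_def)
  have Qb: "0 \<le> Q z \<and> Q z \<le> M" if "z \<le> ?l" for z using Q that by (simp add: profile_def)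
  have cv: "convex_on {..?l} Q" using Q by (simp add: profile_def)
  have ends: "d' \<in> ends G \<longleftrightarrow> fst d' \<in> edges G" for d' by (cases d') (auto simp: ends_def)
  have q0: "?q e = (\<lambda>_. 0)" if "e \<noteq> fst d" for e using that by (auto simp: leaf_potential_def)
  have qd: "?q (fst d) = (\<lambda>x. Q (end_dist G d x))" by (auto simp: leaf_potential_def)
  have vr: "vert G ?r = dhead G d" "dhead G ?r = vert G d" by (auto simp: dhead_def)
  have "well_defined_on G ?q"
  proof -
    have val: "?q (fst d') (end_coord G d') = (if d' = ?r then Q ?l else 0)" for d'
    proof (cases "fst d' = fst d")
      case True
      have "d \<noteq> ?r" by (cases d) auto
      then show ?thesis using end_cases[OF True] by (auto simp: qd Q0)
    next
      case False
      then show ?thesis using q0 by auto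
    qed
    have "d' = ?r \<longleftrightarrow> vert G d' = dhead G d" if "d' \<in> ends G" for d'
      using leaf[of d'] that vr(1) unfolding ends by blast
    then show ?thesis unfolding well_defined_on_def val by simp
  qed
  moreover have "0 \<le> ?q e x \<and> ?q e x \<le> M" if "e \<in> edges G" "x \<in> {0..len G e}" for e x
  proof (cases "e = fst d")
    case True
    then show ?thesis using Qb[of "end_dist G d x"] end_dist_mem[of x G d] that by (simp add: qd)
  next
    case False
    then show ?thesis using q0 M by simp
  qed
  moreover have "convex_on {0..path_length G ds} (along G ?q ds)"
    if p: "graph_path G v ds w" for v ds w
  proof (cases "\<exists>d'\<in>set ds. fst d' = fst d")
    case False
    then have "along G ?q ds = (\<lambda>_. 0)" using along_zero_outside[of ds ?q G] q0 by blast
    then show ?thesis by (simp add: convex_on_def)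
  next
    case True
    then obtain d' where d': "d' \<in> set ds" "fst d' = fst d" by blast
    then obtain as bs where ds: "ds = as @ d' # bs" by (meson split_list)
    have dist: "distinct (map fst ds)" by (rule graph_path_distinct_edges[OF p])
    have wk: "walk G v ds w" using p by (simp add: graph_path_def)
    then obtain b where wb: "walk G v as b" "walk G b (d' # bs) w" 
      using walk_appendD[of G v as "d' # bs" w] unfolding ds by blast
    have other: "fst e \<noteq> fst d" if "e \<in> set as \<union> set bs" for e
    proof -
      have "fst d \<notin> fst ` (set as \<union> set bs)" using dist d'(2) unfolding ds by auto
      then show ?thesis using that by (metis imageI)
    qed
    have in_edges: "fst e \<in> edges G" if "e \<in> set ds" for e
    proof -
      have "walk G v ds w \<Longrightarrow> e \<in> set ds \<Longrightarrow> e \<in> ends G" for v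
        by (induction ds arbitrary: v) auto
      then show ?thesis using wk that ends by blast
    qed
    from end_cases[OF d'(2)] show ?thesis
    proof
      assume e: "d' = d"
      have "bs = []"
      proof (cases bs)
        case (Cons b1 bs')
        then have "vert G b1 = dhead G d" "b1 \<in> ends G" using wb(2) e by auto
        then have "b1 = ?r" using leaf ends by blast
        then show ?thesis using other[of b1] Cons by auto
      qed
      then have ds': "ds = as @ [d]" using ds e by simp
      have "along G ?q ds t = Q (t - path_length G as)" if "t \<in> {0..path_length G ds}" for t
        unfolding ds'
        by (rule along_snoc[where q = ?q, OF Q0 qd]) (use that ds' other q0 in_edges len in auto)
      moreover have "path_length G ds = path_length G as + ?l" by (simp add: ds' path_length_def)
      ultimately show ?thesis
        by (intro convex_on_affine[OF cv, of "\<lambda>t. t - path_length G as" "- path_length G as" 1]) auto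
    next
      assume e: "d' = ?r"
      have "as = []"
      proof (cases as rule: rev_cases)
        case (snoc as' a1)
        then have "walk G v (as' @ [a1]) b" using wb(1) by simp
        then obtain c where "walk G c [a1] b" using walk_appendD[of G v as' "[a1]" b] by blast
        then have a1: "dhead G a1 = b" "a1 \<in> ends G" by auto
        have "dhead G d = b" using wb(2) e by (simp add: dhead_def)
        then have "vert G (fst a1, \<not> snd a1) = dhead G d" using a1(1) by (simp add: dhead_def)
        moreover have "fst (fst a1, \<not> snd a1) \<in> edges G" using a1(2) unfolding ends by simp
        ultimately have "(fst a1, \<not> snd a1) = ?r" using leaf by blast
        then have "fst a1 = fst d" by simp
        then show ?thesis using other[of a1] snoc by simp
      qed
      then have ds': "ds = ?r # bs" using ds e by simp
      have "along G ?q bs t = 0" for t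
        by (rule along_zero_outside) (use other q0 in auto)
      then have "along G ?q ds t = Q (?l - t)" if "t \<in> {0..path_length G ds}" for t
        by (auto simp: ds' qd end_dist_def Q0)
      then show ?thesis
        by (intro convex_on_affine[OF cv, of "\<lambda>t. ?l - t" ?l "- 1"]) auto
    qed
  qed
  ultimately show ?thesis by (auto simp: convex_potentials_def)
qed

lemma leaf_potential_continuous:
  assumes Q: "profile (len G (fst d)) M Q"
  shows "continuous_on {0..len G e} (leaf_potential G d Q e)"
proof (cases "e = fst d")
  case True
  have c: "continuous_on {0..len G (fst d)} Q" using Q by (simp add: profile_def)
  have "continuous_on {0..len G (fst d)} (\<lambda>x. Q (end_dist G d x))"
  proof (rule continuous_on_compose2[OF c])
    show "continuous_on {0..len G (fst d)} (end_dist G d)"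
      unfolding end_dist_def by (cases "snd d") (auto intro!: continuous_intros)
  qed (use end_dist_mem[of _ G d] in blast)
  then show ?thesis by (simp add: leaf_potential_def True)
next
  case False
  then show ?thesis by (simp add: leaf_potential_def)
qed

section \<open>Cutting an eigenfunction off\<close>

text \<open>
  Replacing \<open>u\<close> by \<open>0\<close> on one side \<open>Y\<close> of an edge \<open>e\<close> where it vanishes identically leaves all vertex
  conditions intact: both \<open>u\<close> and its derivative are \<open>0\<close> on \<open>e\<close>. The remaining function does not
  notice a potential that lives on the other side.
\<close>

lemma cut_eigenfunction:
  assumes len: "\<And>e. e \<in> edges G \<Longrightarrow> 0 < len G e"
    and u: "eigenfunction G (\<lambda>_ _. 0) \<mu> u"
    and e: "e \<in> edges G" "\<And>x. x \<in> {0..len G e} \<Longrightarrow> u e x = 0"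
    and f: "f \<in> edges G" "\<And>b. vert G (f, b) \<notin> Y" "x0 \<in> {0..len G f}" "u f x0 \<noteq> 0"
    and Y: "\<And>h. h \<in> edges G \<Longrightarrow> h \<noteq> e \<Longrightarrow> vert G (h, False) \<in> Y \<longleftrightarrow> vert G (h, True) \<in> Y"
    and q: "\<And>h. h \<in> edges G \<Longrightarrow> continuous_on {0..len G h} (q h)"
    and q0: "\<And>h x. h \<in> edges G \<Longrightarrow> vert G (h, False) \<notin> Y \<Longrightarrow> vert G (h, True) \<notin> Y \<Longrightarrow> q h x = 0"
  shows "\<exists>w. eigenfunction G q \<mu> w"
proof -
  have c0: "continuous_on {0..len G h} ((\<lambda>_ _. 0) h :: real \<Rightarrow> real)" for h by simp
  obtain u' where u': "classical G (\<lambda>_ _. 0) \<mu> u u'"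
    using u schroedinger_iff_classical[OF len c0] by (auto simp: eigenfunction_def eigenspace_def)
  have u'0: "u' e x = 0" if x: "x \<in> {0..len G e}" for x
  proof -
    have "(u e has_real_derivative 0) (at x within {0..len G e})"
      by (rule deriv_within_transform[OF DERIV_const[of 0] x]) (use e(2) in simp)
    then show ?thesis using deriv_within_unique[OF len[OF e(1)] x] classical_derivs(1)[OF u' e(1) x] by blast
  qed
  define far where "far h \<longleftrightarrow> vert G (h, False) \<in> Y \<or> vert G (h, True) \<in> Y" for h
  define w where "w h x = (if far h then 0 else u h x)" for h x
  define w' where "w' h x = (if far h then 0 else u' h x)" for h x
  have ec: "end_coord G d \<in> {0..len G (fst d)}" if "d \<in> ends G" for d
    by (rule end_coord_mem(1)[OF that len])
  have far_in: "far (fst d)" if "vert G d \<in> Y" for d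
    using that by (cases d; cases "snd d") (auto simp: far_def)
  have far_out: "fst d = e" if "far (fst d)" "d \<in> ends G" "vert G d \<notin> Y" for d
    using that Y[of "fst d"] by (cases d; cases "snd d") (auto simp: far_def ends_def)
  have wu: "w (fst d) (end_coord G d) = (if vert G d \<in> Y then 0 else u (fst d) (end_coord G d))"
    and nd: "normal_deriv G w' d = (if vert G d \<in> Y then 0 else normal_deriv G u' d)"
    if d: "d \<in> ends G" for d
  proof -
    have "u (fst d) (end_coord G d) = 0 \<and> u' (fst d) (end_coord G d) = 0"
      if "far (fst d)" "vert G d \<notin> Y"
      using far_out[OF that(1) d that(2)] ec[OF d] e(2) u'0 by metis
    then show "w (fst d) (end_coord G d) = (if vert G d \<in> Y then 0 else u (fst d) (end_coord G d))"
      and "normal_deriv G w' d = (if vert G d \<in> Y then 0 else normal_deriv G u' d)"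
      using far_in[of d] by (simp_all add: w_def w'_def normal_deriv_def)
  qed
  have "well_defined_on G w"
    unfolding well_defined_on_def
  proof (intro ballI impI)
    fix d d' assume d: "d \<in> ends G" "d' \<in> ends G" "vert G d = vert G d'"
    then have "u (fst d) (end_coord G d) = u (fst d') (end_coord G d')"
      using u' unfolding classical_def well_defined_on_def by blast
    then show "w (fst d) (end_coord G d) = w (fst d') (end_coord G d')" using d by (simp add: wu)
  qed
  moreover have "kirchhoff G w'"
    unfolding kirchhoff_def
  proof
    fix v assume v: "v \<in> vertices G"
    have "(\<Sum>d | d \<in> ends G \<and> vert G d = v. normal_deriv G w' d)
        = (\<Sum>d | d \<in> ends G \<and> vert G d = v. if v \<in> Y then 0 else normal_deriv G u' d)"
      by (rule sum.cong) (auto simp: nd)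
    also have "\<dots> = 0" using u' v by (cases "v \<in> Y") (simp_all add: classical_def kirchhoff_def)
    finally show "(\<Sum>d | d \<in> ends G \<and> vert G d = v. normal_deriv G w' d) = 0" .
  qed
  moreover have "solves G (edges G) q \<mu> w w'"
    unfolding solves_def
  proof (intro ballI conjI)
    fix h x assume h: "h \<in> edges G" and x: "x \<in> {0..len G h}"
    have wh: "w h = (if far h then (\<lambda>_. 0) else u h)" "w' h = (if far h then (\<lambda>_. 0) else u' h)"
      by (auto simp: w_def w'_def)
    show "(w h has_real_derivative w' h x) (at x within {0..len G h})"
      using classical_derivs(1)[OF u' h x] by (simp add: wh)
    show "(w' h has_real_derivative (q h x - \<mu>) * w h x) (at x within {0..len G h})"
      using classical_derivs(2)[OF u' h x] q0[OF h, of x] by (auto simp: wh far_def)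
  qed
  ultimately have "schroedinger G q w (\<lambda>e x. \<mu> * w e x)"
    using schroedinger_iff_classical[OF len q] by (auto simp: classical_def)
  moreover have "w h x = 0" if "\<not> (h \<in> edges G \<and> x \<in> {0..len G h})" for h x
    using that u by (auto simp: w_def eigenfunction_def eigenspace_def)
  moreover have "w f x0 \<noteq> 0" using f by (auto simp: w_def far_def)
  ultimately show ?thesis
    by (intro exI[of _ w]) (auto simp: eigenfunction_def eigenspace_def)
qed

section \<open>Comparison of the spectral gaps\<close>

definition ground_state :: "('e, 'v) metric_graph \<Rightarrow> ('e \<Rightarrow> real \<Rightarrow> real) \<Rightarrow> real \<Rightarrow> ('e \<Rightarrow> real \<Rightarrow> real) \<Rightarrow>
    ('e \<Rightarrow> real \<Rightarrow> real) \<Rightarrow> bool" where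
  "ground_state G q \<mu> \<phi> \<phi>' \<longleftrightarrow> classical G q \<mu> \<phi> \<phi>' \<and> (\<forall>e\<in>edges G. \<forall>x\<in>{0..len G e}. 0 < \<phi> e x)"

lemma ground_state_lower_bound:
  assumes fin: "finite (edges G)" and len: "\<And>e. e \<in> edges G \<Longrightarrow> 0 < len G e"
    and q: "\<And>e. e \<in> edges G \<Longrightarrow> continuous_on {0..len G e} (q e)"
    and \<phi>: "ground_state G q \<mu> \<phi> \<phi>'" and u: "eigenfunction G q \<nu> u"
  shows "\<mu> \<le> \<nu>"
proof (rule ccontr)
  assume "\<not> \<mu> \<le> \<nu>"
  then have \<nu>: "\<nu> \<le> \<mu>" "\<mu> - \<nu> \<noteq> 0" by auto
  obtain u' where u': "classical G q \<nu> u u'"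
    using u schroedinger_iff_classical[OF len q] by (auto simp: eigenfunction_def eigenspace_def)
  have "u e x = 0" for e x
  proof (cases "e \<in> edges G \<and> x \<in> {0..len G e}")
    case True
    have "(\<mu> - \<nu>) * (u e x)\<^sup>2 = 0"
      by (rule ground_state_comparison(1)[OF fin len _ _ u' \<nu>(1)]) (use \<phi> True in \<open>auto simp: ground_state_def\<close>)
    then show ?thesis using \<nu>(2) by simp
  next
    case False
    then show ?thesis using u by (auto simp: eigenfunction_def eigenspace_def)
  qed
  then have "u = (\<lambda>_ _. 0)" by blast
  then show False using u by (simp add: eigenfunction_def)
qed

text \<open>
  A lower bound of all eigenvalues bounds the set whose infimum defines the \<open>k\<close>-th eigenvalue, since
  a positive sum of multiplicities contains an actual eigenvalue.
\<close>

lemma eigenvalue_bound: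
  assumes \<mu>: "\<And>\<nu> u. eigenfunction G q \<nu> u \<Longrightarrow> \<mu> \<le> \<nu>" and k: "1 \<le> k"
    and F: "finite F" "F \<subseteq> {..x}" "k \<le> (\<Sum>\<nu>\<in>F. multiplicity_eig G q \<nu>)"
  shows "\<mu> \<le> x"
proof -
  obtain \<nu> where \<nu>: "\<nu> \<in> F" "multiplicity_eig G q \<nu> \<noteq> 0"
    using k F(3) by (metis le_zero_eq not_one_le_zero order_trans sum.neutral)
  have "\<exists>u. eigenfunction G q \<nu> u"
  proof (rule ccontr)
    assume "\<not> ?thesis"
    then have "eigenspace G q \<nu> \<subseteq> {0}" by (auto simp: eigenfunction_def zero_fun_def)
    then have "funs.dim (eigenspace G q \<nu>) \<le> card ({} :: ('a \<Rightarrow> real \<Rightarrow> real) set)"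
      by (intro funs.dim_le_card) (auto simp: funs.span_empty)
    then show False using \<nu>(2) by (simp add: multiplicity_eig_def)
  qed
  then show ?thesis using \<mu> \<nu>(1) F(2) by force
qed

lemma eigenvalue_ge:
  assumes \<mu>: "\<And>\<nu> u. eigenfunction G q \<nu> u \<Longrightarrow> \<mu> \<le> \<nu>" and k: "1 \<le> k"
    and F: "finite F" "k \<le> (\<Sum>\<nu>\<in>F. multiplicity_eig G q \<nu>)"
  shows "\<mu> \<le> eigenvalue G q k"
  unfolding eigenvalue_def
proof (rule cInf_greatest)
  have "F \<subseteq> {..Max F}" using F(1) by auto
  then show "{x. \<exists>F. finite F \<and> F \<subseteq> {..x} \<and> k \<le> (\<Sum>\<mu>\<in>F. multiplicity_eig G q \<mu>)} \<noteq> {}" using F by blast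
next
  fix x assume "x \<in> {x. \<exists>F. finite F \<and> F \<subseteq> {..x} \<and> k \<le> (\<Sum>\<mu>\<in>F. multiplicity_eig G q \<mu>)}"
  then obtain F where F: "finite F" "F \<subseteq> {..x}" "k \<le> (\<Sum>\<mu>\<in>F. multiplicity_eig G q \<mu>)" by blast
  show "\<mu> \<le> x" by (rule eigenvalue_bound[OF \<mu> k F])
qed

lemma eigenvalue_le:
  assumes \<mu>: "\<And>\<nu> u. eigenfunction G q \<nu> u \<Longrightarrow> \<mu> \<le> \<nu>" and k: "1 \<le> k"
    and F: "finite F" "F \<subseteq> {..x}" "k \<le> (\<Sum>\<nu>\<in>F. multiplicity_eig G q \<nu>)"
  shows "eigenvalue G q k \<le> x"
  unfolding eigenvalue_def
proof (rule cInf_lower)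
  show "bdd_below {x. \<exists>F. finite F \<and> F \<subseteq> {..x} \<and> k \<le> (\<Sum>\<mu>\<in>F. multiplicity_eig G q \<mu>)}"
  proof (rule bdd_belowI[of _ \<mu>])
    fix x assume "x \<in> {x. \<exists>F. finite F \<and> F \<subseteq> {..x} \<and> k \<le> (\<Sum>\<mu>\<in>F. multiplicity_eig G q \<mu>)}"
    then obtain F where F: "finite F" "F \<subseteq> {..x}" "k \<le> (\<Sum>\<mu>\<in>F. multiplicity_eig G q \<mu>)" by blast
    show "\<mu> \<le> x" by (rule eigenvalue_bound[OF \<mu> k F])
  qed
qed (use F in blast)

lemma constants_classical: "classical G (\<lambda>_ _. 0) 0 (\<lambda>_ _. 1) (\<lambda>_ _. 0)"
  by (auto simp: classical_def well_defined_on_def solves_def kirchhoff_def normal_deriv_zero)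

lemma ground_state_eigenfunction:
  assumes len: "\<And>e. e \<in> edges G \<Longrightarrow> 0 < len G e"
    and q: "\<And>e. e \<in> edges G \<Longrightarrow> continuous_on {0..len G e} (q e)"
    and \<phi>: "ground_state G q \<mu> \<phi> \<phi>'" and e: "e \<in> edges G"
  shows "\<exists>u. eigenfunction G q \<mu> u"
proof -
  define u where "u e x = (if e \<in> edges G \<and> x \<in> {0..len G e} then \<phi> e x else 0)" for e x
  have ec: "end_coord G d \<in> {0..len G (fst d)}" "fst d \<in> edges G" if "d \<in> ends G" for d
    by (rule end_coord_mem[OF that len], assumption)+
  have ph: "classical G q \<mu> \<phi> \<phi>'" using \<phi> by (simp add: ground_state_def)
  have "well_defined_on G u"
    unfolding well_defined_on_def
  proof (intro ballI impI)
    fix d d' assume d: "d \<in> ends G" "d' \<in> ends G" "vert G d = vert G d'"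
    then have "\<phi> (fst d) (end_coord G d) = \<phi> (fst d') (end_coord G d')"
      using ph unfolding classical_def well_defined_on_def by blast
    then show "u (fst d) (end_coord G d) = u (fst d') (end_coord G d')"
      using ec[OF d(1)] ec[OF d(2)] by (simp add: u_def)
  qed
  moreover have "solves G (edges G) q \<mu> u \<phi>'"
    unfolding solves_def
  proof (intro ballI conjI)
    fix h x assume h: "h \<in> edges G" and x: "x \<in> {0..len G h}"
    show "(u h has_real_derivative \<phi>' h x) (at x within {0..len G h})"
      by (rule deriv_within_transform[OF classical_derivs(1)[OF ph h x] x]) (use h in \<open>simp add: u_def\<close>)
    show "(\<phi>' h has_real_derivative (q h x - \<mu>) * u h x) (at x within {0..len G h})"
      using classical_derivs(2)[OF ph h x] h x by (simp add: u_def)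
  qed
  ultimately have "classical G q \<mu> u \<phi>'" using ph by (simp add: classical_def)
  then have "u \<in> eigenspace G q \<mu>"
    using schroedinger_iff_classical[OF len q] by (auto simp: eigenspace_def u_def)
  moreover have "u e 0 \<noteq> 0" using \<phi> e len[OF e] by (simp add: u_def ground_state_def order_less_imp_not_eq2)
  then have "u \<noteq> (\<lambda>_ _. 0)" by auto
  ultimately show ?thesis by (auto simp: eigenfunction_def)
qed

lemma first_eigenvalue:
  assumes fin: "finite (edges G)" and len: "\<And>e. e \<in> edges G \<Longrightarrow> 0 < len G e"
    and q: "\<And>e. e \<in> edges G \<Longrightarrow> continuous_on {0..len G e} (q e)"
    and \<phi>: "ground_state G q \<mu> \<phi> \<phi>'" and e: "e \<in> edges G"
  shows "eigenvalue G q 1 = \<mu>"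
proof (rule antisym)
  have low: "\<mu> \<le> \<nu>" if "eigenfunction G q \<nu> u" for \<nu> u
    by (rule ground_state_lower_bound[OF fin len q \<phi> that])
  obtain u where u: "eigenfunction G q \<mu> u" using ground_state_eigenfunction[OF len q \<phi> e] by blast
  have m: "1 \<le> multiplicity_eig G q \<mu>" by (rule multiplicity_pos[OF fin len q u])
  show "eigenvalue G q 1 \<le> \<mu>" by (rule eigenvalue_le[OF low, where F = "{\<mu>}"]) (use m in auto)
  show "\<mu> \<le> eigenvalue G q 1" by (rule eigenvalue_ge[OF low, where F = "{\<mu>}"]) (use m in auto)
qed

lemma second_eigenvalue_le:
  assumes fin: "finite (edges G)" and len: "\<And>e. e \<in> edges G \<Longrightarrow> 0 < len G e"
    and q: "\<And>e. e \<in> edges G \<Longrightarrow> continuous_on {0..len G e} (q e)"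
    and \<phi>: "ground_state G q \<mu> \<phi> \<phi>'" and e: "e \<in> edges G"
    and w: "eigenfunction G q \<nu> w" and less: "\<mu> < \<nu>"
  shows "eigenvalue G q 2 \<le> \<nu>"
proof -
  have low: "\<mu> \<le> \<kappa>" if "eigenfunction G q \<kappa> u" for \<kappa> u
    by (rule ground_state_lower_bound[OF fin len q \<phi> that])
  obtain u where u: "eigenfunction G q \<mu> u" using ground_state_eigenfunction[OF len q \<phi> e] by blast
  have "1 \<le> multiplicity_eig G q \<mu>" by (rule multiplicity_pos[OF fin len q u])
  moreover have "1 \<le> multiplicity_eig G q \<nu>" by (rule multiplicity_pos[OF fin len q w])
  ultimately have "2 \<le> (\<Sum>\<kappa>\<in>{\<mu>, \<nu>}. multiplicity_eig G q \<kappa>)" using less by simp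
  then show ?thesis by (intro eigenvalue_le[OF low, where F = "{\<mu>, \<nu>}"]) (use less in auto)
qed

text \<open>
  Comparison with the constant ground state shows that an eigenfunction for a value \<open>\<nu> \<le> 0\<close> has the
  derivative \<open>0\<close>; being zero on one edge it would be zero on the whole connected graph.
\<close>

lemma vanishing_eigenfunction_eigenvalue_pos:
  assumes G: "compact_metric_graph G" and u: "eigenfunction G (\<lambda>_ _. 0) \<nu> u"
    and e: "e \<in> edges G" "\<And>x. x \<in> {0..len G e} \<Longrightarrow> u e x = 0"
  shows "0 < \<nu>"
proof (rule ccontr)
  assume "\<not> 0 < \<nu>"
  then have \<nu>: "\<nu> \<le> 0" by simp
  have fin: "finite (edges G)" and len: "\<And>e. e \<in> edges G \<Longrightarrow> 0 < len G e"
    and conn: "\<And>v w. v \<in> vertices G \<Longrightarrow> w \<in> vertices G \<Longrightarrow> \<exists>ds. walk G v ds w"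
    using G by (auto simp: compact_metric_graph_def)
  have c0: "continuous_on {0..len G h} ((\<lambda>_ _. 0) h :: real \<Rightarrow> real)" for h by simp
  obtain u' where u': "classical G (\<lambda>_ _. 0) \<nu> u u'"
    using u schroedinger_iff_classical[OF len c0] by (auto simp: eigenfunction_def eigenspace_def)
  have u'0: "u' h x = 0" if "h \<in> edges G" "x \<in> {0..len G h}" for h x
    using ground_state_comparison(2)[OF fin len constants_classical _ u' \<nu> that] by simp
  have const: "u h x = u h y" if h: "h \<in> edges G" and x: "x \<in> {0..len G h}" and y: "y \<in> {0..len G h}" for h x y
  proof -
    have mono: "u h a = u h b" if "0 \<le> a" "a \<le> b" "b \<le> len G h" for a b
    proof (rule antisym)
      show "u h a \<le> u h b"
        by (rule nonneg_deriv_within_le[OF classical_derivs(1)[OF u' h]]) (use u'0 h that in auto)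
      have "- u h a \<le> - u h b"
        by (rule nonneg_deriv_within_le[OF DERIV_minus[OF classical_derivs(1)[OF u' h]]]) (use u'0 h that in auto)
      then show "u h b \<le> u h a" by simp
    qed
    show ?thesis
    proof (cases "x \<le> y")
      case True
      then show ?thesis using mono[of x y] x y by simp
    next
      case False
      then show ?thesis using mono[of y x] x y by simp
    qed
  qed
  have ec: "end_coord G d \<in> {0..len G (fst d)}" "fst d \<in> edges G" if "d \<in> ends G" for d
    by (rule end_coord_mem[OF that len], assumption)+
  have same: "at_end G u d = at_end G u d'" if "d \<in> ends G" "d' \<in> ends G" "vert G d = vert G d'" for d d'
    using well_defined_at_end that u' unfolding classical_def by blast
  have spread: "walk G v ds w \<Longrightarrow> (\<And>d. d \<in> ends G \<Longrightarrow> vert G d = v \<Longrightarrow> at_end G u d = 0)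
      \<Longrightarrow> d' \<in> ends G \<Longrightarrow> vert G d' = w \<Longrightarrow> at_end G u d' = 0" for v ds w d'
  proof (induction ds arbitrary: v)
    case (Cons d ds)
    have d: "d \<in> ends G" "vert G d = v" "walk G (dhead G d) ds w" using Cons.prems(1) by auto
    let ?r = "(fst d, \<not> snd d)"
    have r: "?r \<in> ends G" "vert G ?r = dhead G d" using d by (cases d; auto simp: ends_def dhead_def)+
    have "at_end G u ?r = at_end G u d"
      using const[OF ec(2)[OF d(1)] _ ec(1)[OF d(1)]] ec(1)[OF r(1)] by (simp add: at_end_def)
    then have "at_end G u d'' = 0" if "d'' \<in> ends G" "vert G d'' = dhead G d" for d''
      using same[OF that(1) r(1)] that(2) r(2) Cons.prems(2)[OF d(1,2)] by simp
    then show ?case using Cons.IH[OF d(3)] Cons.prems(3,4) by blast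
  qed auto
  have "u h x = 0" for h x
  proof (cases "h \<in> edges G \<and> x \<in> {0..len G h}")
    case True
    have E: "(e, False) \<in> ends G" "(h, False) \<in> ends G" using e True by (auto simp: ends_def)
    then obtain ds where ds: "walk G (vert G (e, False)) ds (vert G (h, False))"
      using conn by (metis imageI vertices_def)
    have "at_end G u (e, False) = 0" using e len[OF e(1)] by (simp add: at_end_def end_coord_def)
    then have "at_end G u d = 0" if "d \<in> ends G" "vert G d = vert G (e, False)" for d
      using same[OF that(1) E(1) that(2)] by simp
    then have "at_end G u (h, False) = 0" using spread[OF ds _ E(2)] by blast
    then show ?thesis
      using const[of h x 0] True len[of h] by (simp add: at_end_def end_coord_def)
  next
    case False
    then show ?thesis using u by (auto simp: eigenfunction_def eigenspace_def)
  qed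
  then have "u = (\<lambda>_ _. 0)" by blast
  then show False using u by (simp add: eigenfunction_def)
qed

theorem corollary5p3:
  fixes G :: "('e, 'v) metric_graph" and M :: real
  assumes "metric_tree G"
    and "\<exists>u. eigenfunction G (\<lambda>_ _. 0) (eigenvalue G (\<lambda>_ _. 0) 2) u
           \<and> (\<exists>e\<in>edges G. \<forall>x\<in>{0..len G e}. u e x = 0)"
    and "M > 0"
  shows "\<not> is_arg_min (spectral_gap G) (\<lambda>q. q \<in> convex_potentials G M) (\<lambda>_ _. 0)"
proof -
  define \<nu> where "\<nu> = eigenvalue G (\<lambda>_ _. 0) 2"
  obtain u e where u: "eigenfunction G (\<lambda>_ _. 0) \<nu> u" and e: "e \<in> edges G" "\<And>x. x \<in> {0..len G e} \<Longrightarrow> u e x = 0"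
    using assms(2) by (auto simp: \<nu>_def)
  have cmg: "compact_metric_graph G" using assms(1) by (simp add: metric_tree_def)
  then have fin: "finite (edges G)" and len: "\<And>e. e \<in> edges G \<Longrightarrow> 0 < len G e"
    by (auto simp: compact_metric_graph_def)
  have c0: "continuous_on {0..len G h} ((\<lambda>_ _. 0) h :: real \<Rightarrow> real)" for h by simp
  have \<nu>: "0 < \<nu>" by (rule vanishing_eigenfunction_eigenvalue_pos[OF cmg u e])
  have gap0: "spectral_gap G (\<lambda>_ _. 0) = \<nu>"
    using first_eigenvalue[OF fin len c0, of 0 "\<lambda>_ _. 1" "\<lambda>_ _. 0" e] constants_classical[of G] e(1)
    by (simp add: spectral_gap_def \<nu>_def ground_state_def)
  obtain f x0 where f: "f \<in> edges G" "x0 \<in> {0..len G f}" "u f x0 \<noteq> 0"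
    using u by (fastforce simp: eigenfunction_def eigenspace_def fun_eq_iff)
  have ef: "e \<noteq> f" using e f by auto
  obtain es where es: "tree_order G f es" "set es = edges G" using tree_order_exists[OF assms(1) f(1)] by blast
  obtain Y d where Y: "vert G (f, False) \<notin> Y" "vert G (f, True) \<notin> Y"
      "\<And>h. h \<in> edges G \<Longrightarrow> h \<noteq> e \<Longrightarrow> vert G (h, False) \<in> Y \<longleftrightarrow> vert G (h, True) \<in> Y"
    and d: "fst d \<in> edges G" "dhead G d \<in> Y"
      "\<And>d'. fst d' \<in> edges G \<Longrightarrow> vert G d' = dhead G d \<Longrightarrow> d' = (fst d, \<not> snd d)"
    using tree_order_cut[OF es(1) _ ef] e(1) unfolding es(2) by blast
  obtain ds where ds: "tree_order G (fst d) ds" "set ds = edges G"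
    using tree_order_exists[OF assms(1) d(1)] by blast
  obtain \<delta> where \<delta>: "0 < \<delta>" "\<And>\<mu> c. 0 < \<mu> \<and> \<mu> \<le> \<delta> \<and> c (dhead G d) = 0 \<and> (\<forall>v. 0 \<le> c v \<and> c v \<le> 0 * \<mu>) \<Longrightarrow>
    (\<exists>Q \<phi> \<phi>' y. profile (len G (fst d)) M Q \<and> solves G (edges G) (leaf_potential G d Q) \<mu> \<phi> \<phi>'
      \<and> (\<forall>e\<in>edges G. \<forall>x\<in>{0..len G e}. 0 < \<phi> e x)
      \<and> (\<forall>d'. fst d' \<in> edges G \<longrightarrow> at_end G \<phi> d' = y (vert G d'))
      \<and> (\<forall>v\<in>endpoints G (edges G). flux G (edges G) \<phi>' v + c v * y v = 0))"
    using positive_solution[OF ds(1) refl d(3) len assms(3), of 0] unfolding ds(2) by blast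
  \<comment> \<open>The bound by \<open>\<nu> / 2\<close> keeps the new ground state energy below \<open>\<nu>\<close>.\<close>
  define \<mu> where "\<mu> = min \<delta> (\<nu> / 2)"
  have \<mu>: "0 < \<mu>" "\<mu> \<le> \<delta>" "\<mu> < \<nu>" using \<delta>(1) \<nu> by (auto simp: \<mu>_def)
  obtain Q \<phi> \<phi>' y where Q: "profile (len G (fst d)) M Q"
    and s: "solves G (edges G) (leaf_potential G d Q) \<mu> \<phi> \<phi>'"
    and pos: "\<forall>e\<in>edges G. \<forall>x\<in>{0..len G e}. 0 < \<phi> e x"
    and y: "\<forall>d'. fst d' \<in> edges G \<longrightarrow> at_end G \<phi> d' = y (vert G d')"
    and fl: "\<forall>v\<in>endpoints G (edges G). flux G (edges G) \<phi>' v + (\<lambda>_. 0) v * y v = 0"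
    using \<delta>(2)[of \<mu> "\<lambda>_. 0"] \<mu> by auto
  define q where "q = leaf_potential G d Q"
  have qc: "continuous_on {0..len G h} (q h)" for h
    unfolding q_def by (rule leaf_potential_continuous[OF Q])
  have "well_defined_on G \<phi>"
    unfolding well_defined_on_def
  proof (intro ballI impI)
    fix d1 d2 assume "d1 \<in> ends G" "d2 \<in> ends G" "vert G d1 = vert G d2"
    moreover from this have "fst d1 \<in> edges G" "fst d2 \<in> edges G" by (auto simp: ends_def)
    ultimately have "at_end G \<phi> d1 = at_end G \<phi> d2" using y by metis
    then show "\<phi> (fst d1) (end_coord G d1) = \<phi> (fst d2) (end_coord G d2)" by (simp add: at_end_def)
  qed
  moreover have "kirchhoff G \<phi>'"
    using fl by (simp add: kirchhoff_iff_flux endpoints_def vertices_def ends_def)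
  ultimately have gs: "ground_state G q \<mu> \<phi> \<phi>'"
    using s pos by (simp add: ground_state_def classical_def q_def)
  have "\<exists>w. eigenfunction G q \<nu> w"
  proof (rule cut_eigenfunction[OF len u e f(1) _ f(2,3) Y(3) qc])
    show "vert G (f, b) \<notin> Y" for b using Y(1,2) by (cases b) auto
    show "q h x = 0" if h: "vert G (h, False) \<notin> Y" "vert G (h, True) \<notin> Y" for h x
    proof -
      have "h \<noteq> fst d" using h d(2) by (cases "snd d") (auto simp: dhead_def)
      then show ?thesis by (simp add: q_def leaf_potential_def)
    qed
  qed
  then obtain w where w: "eigenfunction G q \<nu> w" by blast
  have "spectral_gap G q \<le> \<nu> - \<mu>"
    unfolding spectral_gap_def
    using first_eigenvalue[OF fin len qc gs e(1)] second_eigenvalue_le[OF fin len qc gs e(1) w \<mu>(3)] by simp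
  then have "spectral_gap G q < spectral_gap G (\<lambda>_ _. 0)" using gap0 \<mu>(1) by simp
  moreover have "q \<in> convex_potentials G M"
    unfolding q_def by (rule leaf_potential_admissible[OF assms(1) d(1,3) Q assms(3)])
  ultimately show ?thesis by (auto simp: is_arg_min_def)
qed

end
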